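(* Let $A\in 2^\omega$. The following are equivalent: (i) $A\in\mathrm{Low}(\mathrm{MLR},\mathrm{SR})$, i.e., $\mathrm{MLR}\subseteq\mathrm{SR}^A$. (ii) For every $A$-computable function $f:\mathbb{N}\to\mathbb{R}^{\geq 0}$ whose sum $\sum_n f(n)$ is finite and computable, there exists a left-c.e. summable function $g:\mathbb{N}\to\mathbb{R}^{\geq 0}$ such that $f\leq g$. Moreover, the equivalence also holds if in (ii) the condition that $\sum_n f(n)$ is finite and computable is replaced by the condition that $\sum_n f(n)$ is finite and $A$-computable.
   Context: $f\leq g$ means $f(n)\leq g(n)$ for all $n$. A function $g:\mathbb{N}\to\mathbb{R}^{\geq 0}$ is summable if $\sum_n g(n)<+\infty$, and left-c.e. if the values $g(n)$ are, uniformly in $n$, limits of computable non-decreasing sequences of rationals. Computability of real-valued functions is meant in the usual sense (uniform approximation of the values by rationals to any prescribed precision), relativized to $A$ where indicated. $2^\omega$ is Cantor space with uniform measure $\mu$. A Martin-Löf test is a non-increasing sequence $(\mathcal{U}_n)_{n\in\mathbb{N}}$ of uniformly c.e. open subsets of $2^\omega$ with $\mu(\mathcal{U}_n)\leq 2^{-n}$ for all $n$; $\mathrm{MLR}$ is the set of $X$ with $X\notin\bigcap_n\mathcal{U}_n$ for every Martin-Löf test. An $A$-Schnorr test is a non-increasing sequence $(\mathcal{U}_n)_{n\in\mathbb{N}}$ of uniformly $A$-c.e. open sets with $\mu(\mathcal{U}_n)=2^{-n}$ for all $n$; $\mathrm{SR}^A$ is the set of $X$ with $X\notin\bigcap_n\mathcal{U}_n$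 for every $A$-Schnorr test. *)

theory Defs
  imports "HOL-Probability.Probability" "HOL-Library.Nat_Bijection"
begin

section \<open>Partial recursive functions with an oracle\<close>

text \<open>
  Kleene's schemata, presented for unary functions on the natural numbers; several arguments are
  combined by the (primitive recursive) Cantor pairing function \<^const>\<open>prod_encode\<close>, so
  that the projections and tupling replace the usual multi-ary schemata.
\<close>

type_synonym cantor = "nat \<Rightarrow> bool"

datatype prog =
    Zero | Succ | Fst | Snd | Query
  | Tuple prog prog
  | Comp prog prog
  | PrimRec prog prog
  | Minimize prog

primrec run :: "cantor \<Rightarrow> prog \<Rightarrow> nat \<rightharpoonup> nat" where
  "run A Zero = (\<lambda>x. Some 0)"
| "run A Succ = (\<lambda>x. Some (Suc x))"
| "run A Fst = (\<lambda>x. Some (fst (prod_decode x)))"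
| "run A Snd = (\<lambda>x. Some (snd (prod_decode x)))"
| "run A Query = (\<lambda>x. Some (if A x then 1 else 0))"
| "run A (Tuple p q) = (\<lambda>x. Option.bind (run A p x) (\<lambda>a.
     Option.bind (run A q x) (\<lambda>b. Some (prod_encode (a, b)))))"
| "run A (Comp p q) = (\<lambda>x. Option.bind (run A q x) (run A p))"
| "run A (PrimRec p q) = (\<lambda>x. case prod_decode x of (a, n) \<Rightarrow>
     rec_nat (run A p a)
       (\<lambda>m r. Option.bind r (\<lambda>v. run A q (prod_encode (a, prod_encode (m, v))))) n)"
| "run A (Minimize p) = (\<lambda>x.
     if \<exists>n. run A p (prod_encode (x, n)) = Some 0 \<and>
            (\<forall>m<n. \<exists>v. run A p (prod_encode (x, m)) = Some (Suc v))
     then Some (LEAST n. run A p (prod_encode (x, n)) = Some 0)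
     else None)"

definition computable_in :: "cantor \<Rightarrow> (nat \<Rightarrow> nat) \<Rightarrow> bool" where
  "computable_in A f \<longleftrightarrow> (\<exists>p. \<forall>x. run A p x = Some (f x))"

definition ce_in :: "cantor \<Rightarrow> nat set \<Rightarrow> bool" where
  "ce_in A W \<longleftrightarrow> (\<exists>p. W = dom (run A p))"

text \<open>Unrelativized notions are those relative to the empty oracle.\<close>

abbreviation no_oracle :: cantor where
  "no_oracle \<equiv> (\<lambda>_. False)"


section \<open>Computable and left-c.e. real-valued functions\<close>

text \<open>A numbering of the rationals: the code of the pair \<open>(a, b)\<close> denotes
  \<open>int_decode a / (b + 1)\<close>.\<close>

definition rat_of_code :: "nat \<Rightarrow> rat" where
  "rat_of_code c =
     (case prod_decode c of (a, b) \<Rightarrow> of_int (int_decode a) / of_nat (Suc b))"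

definition computable_rat_array_in :: "cantor \<Rightarrow> (nat \<Rightarrow> nat \<Rightarrow> rat) \<Rightarrow> bool" where
  "computable_rat_array_in A q \<longleftrightarrow>
     (\<exists>h. computable_in A h \<and> (\<forall>n k. q n k = rat_of_code (h (prod_encode (n, k)))))"

definition computable_real_fun_in :: "cantor \<Rightarrow> (nat \<Rightarrow> real) \<Rightarrow> bool" where
  "computable_real_fun_in A f \<longleftrightarrow>
     (\<exists>q. computable_rat_array_in A q \<and> (\<forall>n k. \<bar>f n - of_rat (q n k)\<bar> \<le> 1 / 2 ^ k))"

definition computable_real_in :: "cantor \<Rightarrow> real \<Rightarrow> bool" where
  "computable_real_in A r \<longleftrightarrow>
     (\<exists>h. computable_in A h \<and> (\<forall>k. \<bar>r - of_rat (rat_of_code (h k))\<bar> \<le> 1 / 2 ^ k))"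

definition left_ce_fun :: "(nat \<Rightarrow> real) \<Rightarrow> bool" where
  "left_ce_fun g \<longleftrightarrow>
     (\<exists>q. computable_rat_array_in no_oracle q \<and>
          (\<forall>n. incseq (q n) \<and> (\<lambda>k. of_rat (q n k)) \<longlonglongrightarrow> g n))"


section \<open>Cantor space and randomness\<close>

definition cantor_measure :: "cantor measure" where
  "cantor_measure = Pi\<^sub>M UNIV (\<lambda>_. measure_pmf (bernoulli_pmf (1 / 2)))"

definition cylinder :: "bool list \<Rightarrow> cantor set" where
  "cylinder s = {X. \<forall>i<length s. X i = s ! i}"

definition string_code :: "bool list \<Rightarrow> nat" where
  "string_code s = list_encode (map (\<lambda>b. if b then 1 else 0) s)"

definition uniformly_ce_open_in :: "cantor \<Rightarrow> (nat \<Rightarrow> cantor set) \<Rightarrow> bool" where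
  "uniformly_ce_open_in A U \<longleftrightarrow>
     (\<exists>W. ce_in A W \<and>
          (\<forall>n. U n = (\<Union>s\<in>{s. prod_encode (n, string_code s) \<in> W}. cylinder s)))"

definition MartinLoef_test :: "(nat \<Rightarrow> cantor set) \<Rightarrow> bool" where
  "MartinLoef_test U \<longleftrightarrow> decseq U \<and> uniformly_ce_open_in no_oracle U \<and>
     (\<forall>n. measure cantor_measure (U n) \<le> 1 / 2 ^ n)"

definition Schnorr_test_in :: "cantor \<Rightarrow> (nat \<Rightarrow> cantor set) \<Rightarrow> bool" where
  "Schnorr_test_in A U \<longleftrightarrow> decseq U \<and> uniformly_ce_open_in A U \<and>
     (\<forall>n. measure cantor_measure (U n) = 1 / 2 ^ n)"

definition MLR :: "cantor set" where
  "MLR = {X. \<forall>U. MartinLoef_test U \<longrightarrow> X \<notin> (\<Inter>n. U n)}"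

definition SR :: "cantor \<Rightarrow> cantor set" where
  "SR A = {X. \<forall>U. Schnorr_test_in A U \<longrightarrow> X \<notin> (\<Inter>n. U n)}"

definition Low :: "cantor set \<Rightarrow> (cantor \<Rightarrow> cantor set) \<Rightarrow> cantor set" where
  "Low C D = {A. C \<subseteq> D A}"

end

theory Submission
  imports Defs
begin

text \<open>
  Write \<open>val t X\<close> for the number below \<open>2 ^ t\<close> whose binary digits are the first \<open>t\<close> bits of
  \<open>X\<close>. Effectively open sets are then the sets \<open>{X. \<exists>t. P t (val t X)}\<close> with \<open>P\<close> decidable, and the
  measure of a clopen approximation is obtained by counting numbers below \<open>2 ^ t\<close>. The passage from
  domains of partial recursive functions to this form is made separately for each program: induction on
  the program yields a total computable function that reports the output as soon as it is found by
  stage \<open>t\<close> (\<open>ex_stage_approx\<close>).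

  \<^emph>\<open>Bounds imply lowness\<close> (\<open>MLR_subset_SR_if_bounded\<close>). Split the components of an \<open>A\<close>-Schnorr test
  into disjoint cylinders, each enumerated at the stage equal to its length. Whether a given cylinder
  is enumerated is then decidable in \<open>A\<close>, so the function \<open>f\<close> assigning to it its measure, and \<open>0\<close>
  to all other cylinders, is \<open>A\<close>-computable, with sum \<open>\<Sum>n. 2^-n = 2\<close>. If \<open>g\<close> is a summable left-c.e.
  bound of \<open>f\<close>, the cylinders to which \<open>g\<close> assigns more than half of their measure have summable
  measures and can be enumerated without the oracle. By Markov's inequality the sets of points lying
  in many of them form a Martin-Loef test (\<open>heavy_cylinders_test\<close>), which captures every point that the
  Schnorr test captures.

  \<^emph>\<open>Lowness implies bounds\<close> (\<open>bounded_if_Low\<close>), even if the sum of \<open>f\<close> is only \<open>A\<close>-computable. Up to finitely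
  many arguments, \<open>f i \<le> 2 ^ - k i\<close> for an \<open>A\<close>-computable \<open>k\<close> for which the sums of \<open>2 ^ - k i\<close> still have
  \<open>A\<close>-computable tails (\<open>ex_dyadic_majorant\<close>). Represent the pair \<open>c = (i, k)\<close> by the event \<open>B c\<close> that \<open>X\<close>
  vanishes on a block of \<open>k\<close> coordinates reserved for \<open>c\<close>; these events are independent and have
  measure \<open>2 ^ - k\<close>. The unions of the \<open>B (i, k i)\<close> over tails of \<open>i\<close> have \<open>A\<close>-computable measure, so they can
  be enlarged to an \<open>A\<close>-Schnorr test \<open>V\<close> with the exact measures required (\<open>Schnorr_padding\<close>).

  Suppose first that some \<open>V n\<close> is contained, up to a null set, in a c.e. open set \<open>G\<close> of measure below
  \<open>1\<close>. Enumerate all \<open>c\<close> for which \<open>B c - G\<close> is seen to be tiny, where tiny means bounded by a fixed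
  summable sequence of total weight at most half the measure of the complement of \<open>G\<close>. All \<open>c\<close> with
  \<open>B c\<close> almost contained in \<open>G\<close> are enumerated. On the other hand, a set of positive measure avoids all
  enumerated \<open>B c\<close>, hence by independence the product of the \<open>1 - 2 ^ - k\<close> over them is positive and the
  sum of the \<open>2 ^ - k\<close> is finite (\<open>few_blocks_nearly_covered\<close>). The function \<open>g i\<close> that sums \<open>2 ^ - k\<close> over
  the enumerated pairs \<open>(i, k)\<close> is therefore left-c.e. and summable, and it bounds \<open>f\<close> at all but finitely many
  arguments.

  Otherwise every \<open>V n\<close> meets the complement of every c.e. open set of measure below \<open>1\<close> in positive
  measure. Then a point can be built by finite extension that enters each \<open>V n\<close> and
  avoids one component of each of the countably many Martin-Loef tests, so \<open>V\<close> captures a random point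
  (\<open>ex_cover_if_Low\<close>). Asking for positive measure, and not merely for a nonempty intersection, is what
  keeps the extension going when further small open sets have to be avoided.
\<close>

section \<open>Closure properties of computable functions\<close>

abbreviation p1 :: "nat \<Rightarrow> nat" where "p1 x \<equiv> fst (prod_decode x)"
abbreviation p2 :: "nat \<Rightarrow> nat" where "p2 x \<equiv> snd (prod_decode x)"

abbreviation computable2 :: "cantor \<Rightarrow> (nat \<Rightarrow> nat \<Rightarrow> nat) \<Rightarrow> bool" where
  "computable2 A h \<equiv> computable_in A (\<lambda>y. h (p1 y) (p2 y))"

abbreviation computable3 :: "cantor \<Rightarrow> (nat \<Rightarrow> nat \<Rightarrow> nat \<Rightarrow> nat) \<Rightarrow> bool" where
  "computable3 A h \<equiv> computable_in A (\<lambda>y. h (p1 y) (p1 (p2 y)) (p2 (p2 y)))"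

text \<open>
  Decidability is computability of the characteristic function, so that the closure rules for functions
  and predicates can be applied by one goal-directed search.
\<close>
definition decidable_in :: "cantor \<Rightarrow> (nat \<Rightarrow> bool) \<Rightarrow> bool" where
  "decidable_in A P \<longleftrightarrow> computable_in A (\<lambda>x. of_bool (P x))"

abbreviation decidable2 :: "cantor \<Rightarrow> (nat \<Rightarrow> nat \<Rightarrow> bool) \<Rightarrow> bool" where
  "decidable2 A P \<equiv> decidable_in A (\<lambda>y. P (p1 y) (p2 y))"

abbreviation decidable3 :: "cantor \<Rightarrow> (nat \<Rightarrow> nat \<Rightarrow> nat \<Rightarrow> bool) \<Rightarrow> bool" where
  "decidable3 A P \<equiv> decidable_in A (\<lambda>y. P (p1 y) (p1 (p2 y)) (p2 (p2 y)))"

named_theorems computability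

lemma computable_id [computability]: "computable_in A (\<lambda>x. x)"
  unfolding computable_in_def by (rule exI[of _ "Tuple Fst Snd"]) simp

lemma computable_comp:
  assumes "computable_in A f" "computable_in A g"
  shows "computable_in A (\<lambda>x. f (g x))"
proof -
  obtain p q where "\<And>x. run A p x = Some (f x)" "\<And>x. run A q x = Some (g x)"
    using assms unfolding computable_in_def by auto
  then show ?thesis
    unfolding computable_in_def by (intro exI[of _ "Comp p q"]) simp
qed

lemma computable_zero: "computable_in A (\<lambda>x. 0)"
  unfolding computable_in_def by (rule exI[of _ "Zero"]) simp

lemma computable_Suc [computability]:
  assumes "computable_in A f" shows "computable_in A (\<lambda>x. Suc (f x))"
proof -
  have "computable_in A Suc" unfolding computable_in_def by (rule exI[of _ "Succ"]) simp
  from computable_comp[OF this assms] show ?thesis .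
qed

lemma computable_const [computability]: "computable_in A (\<lambda>x. c)"
  by (induction c) (auto intro: computable_zero computable_Suc)

lemma computable_fst [computability]:
  assumes "computable_in A f" shows "computable_in A (\<lambda>x. p1 (f x))"
proof -
  have "computable_in A (\<lambda>x. p1 x)" unfolding computable_in_def by (rule exI[of _ "Fst"]) simp
  from computable_comp[OF this assms] show ?thesis .
qed

lemma computable_snd [computability]:
  assumes "computable_in A f" shows "computable_in A (\<lambda>x. p2 (f x))"
proof -
  have "computable_in A (\<lambda>x. p2 x)" unfolding computable_in_def by (rule exI[of _ "Snd"]) simp
  from computable_comp[OF this assms] show ?thesis .
qed

lemma computable_pair [computability]:
  assumes "computable_in A f" "computable_in A g"
  shows "computable_in A (\<lambda>x. prod_encode (f x, g x))"
proof -
  obtain p q where "\<And>x. run A p x = Some (f x)" "\<And>x. run A q x = Some (g x)"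
    using assms unfolding computable_in_def by auto
  then show ?thesis
    unfolding computable_in_def by (intro exI[of _ "Tuple p q"]) simp
qed

lemma computable_comp2:
  assumes "computable2 A h" "computable_in A f" "computable_in A g"
  shows "computable_in A (\<lambda>x. h (f x) (g x))"
  using computable_comp[OF assms(1) computable_pair[OF assms(2,3)]] by simp

lemma computable_rec [computability]:
  assumes "computable_in A a" "computable3 A h" "computable_in A n"
  shows "computable_in A (\<lambda>x. rec_nat (a x) (h x) (n x))"
proof -
  obtain p q where p: "\<And>x. run A p x = Some (a x)"
    and q: "\<And>y. run A q y = Some (h (p1 y) (p1 (p2 y)) (p2 (p2 y)))"
    using assms(1,2) unfolding computable_in_def by auto
  have "run A (PrimRec p q) (prod_encode (x, k)) = Some (rec_nat (a x) (h x) k)" for x k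
    by (induction k) (simp_all add: p q)
  then have "run A (PrimRec p q) y = Some (rec_nat (a (p1 y)) (h (p1 y)) (p2 y))" for y
    by (metis prod.collapse prod_decode_inverse)
  then have "computable2 A (\<lambda>x k. rec_nat (a x) (h x) k)"
    unfolding computable_in_def by blast
  from computable_comp2[OF this computable_id assms(3)] show ?thesis .
qed

lemma computable_Least_zero:
  assumes "computable2 A h" "\<And>x. \<exists>n. h x n = 0"
  shows "computable_in A (\<lambda>x. LEAST n. h x n = 0)"
proof -
  obtain p where p: "\<And>y. run A p y = Some (h (p1 y) (p2 y))"
    using assms(1) unfolding computable_in_def by auto
  have "run A (Minimize p) x = Some (LEAST n. h x n = 0)" for x
  proof -
    have "h x (LEAST n. h x n = 0) = 0" using assms(2) by (rule LeastI_ex)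
    moreover have "\<exists>v. h x m = Suc v" if "m < (LEAST n. h x n = 0)" for m
      using not_less_Least[OF that] by (metis not0_implies_Suc)
    ultimately have "\<exists>n. h x n = 0 \<and> (\<forall>m<n. \<exists>v. h x m = Suc v)" by blast
    then show ?thesis by (simp add: p)
  qed
  then show ?thesis unfolding computable_in_def by blast
qed

lemma computable_query:
  assumes "computable_in A f" shows "decidable_in A (\<lambda>x. A (f x))"
proof -
  have "computable_in A (\<lambda>x. of_bool (A x))"
    unfolding computable_in_def by (rule exI[of _ Query]) (simp add: of_bool_def)
  from computable_comp[OF this assms] show ?thesis unfolding decidable_in_def .
qed

lemma computable_add [computability]:
  assumes "computable_in A f" "computable_in A g"
  shows "computable_in A (\<lambda>x. f x + g x)"
proof -
  have *: "rec_nat a (\<lambda>m. Suc) b = a + b" for a b :: nat by (induction b) auto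
  have "computable_in A (\<lambda>x. rec_nat (f x) (\<lambda>m. Suc) (g x))"
    using assms by (intro computability)
  then show ?thesis unfolding * .
qed

lemma computable_diff [computability]:
  assumes "computable_in A f" "computable_in A g"
  shows "computable_in A (\<lambda>x. f x - g x)"
proof -
  have pred: "rec_nat 0 (\<lambda>m r. m) b = b - 1" for b :: nat by (cases b) auto
  have *: "rec_nat a (\<lambda>m r. rec_nat 0 (\<lambda>m r. m) r) b = a - b" for a b :: nat
    unfolding pred by (induction b) auto
  have "computable_in A (\<lambda>x. rec_nat (f x) (\<lambda>m r. rec_nat 0 (\<lambda>m r. m) r) (g x))"
    using assms by (intro computability)
  then show ?thesis unfolding * .
qed

lemma computable_mult [computability]:
  assumes "computable_in A f" "computable_in A g"
  shows "computable_in A (\<lambda>x. f x * g x)"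
proof -
  have *: "rec_nat 0 (\<lambda>m r. r + a) b = a * b" for a b :: nat by (induction b) auto
  have "computable_in A (\<lambda>x. rec_nat 0 (\<lambda>m r. r + f x) (g x))"
    using assms by (intro computability computable_comp[OF assms(1)])
  then show ?thesis unfolding * .
qed

lemma computable_power [computability]:
  assumes "computable_in A f" "computable_in A g"
  shows "computable_in A (\<lambda>x. f x ^ g x)"
proof -
  have *: "rec_nat 1 (\<lambda>m r. r * a) b = a ^ b" for a b :: nat by (induction b) auto
  have "computable_in A (\<lambda>x. rec_nat 1 (\<lambda>m r. r * f x) (g x))"
    using assms by (intro computability computable_comp[OF assms(1)])
  then show ?thesis unfolding * .
qed

lemma decidable_le [computability]:
  assumes "computable_in A f" "computable_in A g"
  shows "decidable_in A (\<lambda>x. f x \<le> g x)"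
proof -
  have *: "1 - (a - b) = of_bool (a \<le> b)" for a b :: nat by auto
  have "computable_in A (\<lambda>x. 1 - (f x - g x))" using assms by (intro computability)
  then show ?thesis unfolding * decidable_in_def .
qed

lemma computable_of_bool [computability]:
  "decidable_in A P \<Longrightarrow> computable_in A (\<lambda>x. of_bool (P x))"
  unfolding decidable_in_def .

lemma decidable_not [computability]:
  assumes "decidable_in A P" shows "decidable_in A (\<lambda>x. \<not> P x)"
proof -
  have *: "of_bool (\<not> b) = 1 - (of_bool b :: nat)" for b by (cases b) auto
  show ?thesis unfolding decidable_in_def * using assms by (intro computability)
qed

lemma decidable_conj [computability]:
  assumes "decidable_in A P" "decidable_in A Q" shows "decidable_in A (\<lambda>x. P x \<and> Q x)"
  unfolding decidable_in_def of_bool_conj using assms by (intro computability)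

lemma decidable_disj [computability]:
  assumes "decidable_in A P" "decidable_in A Q" shows "decidable_in A (\<lambda>x. P x \<or> Q x)"
proof -
  have "decidable_in A (\<lambda>x. \<not> (\<not> P x \<and> \<not> Q x))" using assms by (intro computability)
  then show ?thesis by simp
qed

lemma decidable_imp [computability]:
  assumes "decidable_in A P" "decidable_in A Q" shows "decidable_in A (\<lambda>x. P x \<longrightarrow> Q x)"
  unfolding imp_conv_disj using assms by (intro computability)

lemma decidable_less [computability]:
  assumes "computable_in A f" "computable_in A g"
  shows "decidable_in A (\<lambda>x. f x < g x)"
  unfolding not_le[symmetric] using assms by (intro computability)

lemma decidable_eq [computability]:
  assumes "computable_in A f" "computable_in A g"
  shows "decidable_in A (\<lambda>x. f x = (g x :: nat))"
  unfolding eq_iff using assms by (intro computability)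

lemma decidable_comp:
  assumes "decidable_in A P" "computable_in A g"
  shows "decidable_in A (\<lambda>x. P (g x))"
  using computable_comp[of A "\<lambda>x. of_bool (P x)" g] assms unfolding decidable_in_def by simp

lemma decidable_comp2:
  assumes "decidable2 A P" "computable_in A f" "computable_in A g"
  shows "decidable_in A (\<lambda>x. P (f x) (g x))"
  using decidable_comp[OF assms(1) computable_pair[OF assms(2,3)]] by simp

lemma decidable_comp3:
  assumes "decidable3 A P" "computable_in A e" "computable_in A f" "computable_in A g"
  shows "decidable_in A (\<lambda>x. P (e x) (f x) (g x))"
  using decidable_comp[OF assms(1) computable_pair[OF assms(2) computable_pair[OF assms(3,4)]]] by simp

lemma computable_if [computability]:
  assumes "decidable_in A P" "computable_in A f" "computable_in A g"
  shows "computable_in A (\<lambda>x. if P x then f x else g x)"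
proof -
  have *: "(if b then u else v) = of_bool b * u + (1 - of_bool b) * v" for b and u v :: nat by simp
  show ?thesis unfolding * using assms by (intro computability)
qed

lemma computable_sum [computability]:
  assumes "computable2 A h" "computable_in A n"
  shows "computable_in A (\<lambda>x. \<Sum>i<n x. h x i)"
proof -
  have *: "rec_nat 0 (\<lambda>m r. r + h x m) b = (\<Sum>i<b. h x i)" for x b by (induction b) auto
  have "computable_in A (\<lambda>x. rec_nat 0 (\<lambda>m r. r + h x m) (n x))"
    using assms by (intro computability computable_comp2[OF assms(1)])
  then show ?thesis unfolding * .
qed

lemma decidable_ex_less [computability]:
  assumes "decidable2 A P" "computable_in A n"
  shows "decidable_in A (\<lambda>x. \<exists>i<n x. P x i)"
proof -
  have *: "(\<exists>i<n x. P x i) \<longleftrightarrow> 0 < (\<Sum>i<n x. of_bool (P x i) :: nat)" for x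
    unfolding of_bool_def by (auto simp: sum_eq_0_iff zero_less_iff_neq_zero simp del: neq0_conv)
  show ?thesis unfolding * using assms by (intro computability)
qed

lemma decidable_all_less [computability]:
  assumes "decidable2 A P" "computable_in A n"
  shows "decidable_in A (\<lambda>x. \<forall>i<n x. P x i)"
proof -
  have "decidable_in A (\<lambda>x. \<not> (\<exists>i<n x. \<not> P x i))" using assms by (intro computability)
  then show ?thesis by simp
qed

lemma computable_Least:
  assumes "decidable2 A P" "\<And>x. \<exists>n. P x n"
  shows "computable_in A (\<lambda>x. LEAST n. P x n)"
proof -
  have "computable2 A (\<lambda>x n. of_bool (\<not> P x n))" using assms(1) by (intro computability)
  from computable_Least_zero[OF this] assms(2) show ?thesis by simp
qed

text \<open>
  Division is obtained by search: the quotient is the first \<open>q\<close> with \<open>a < (q + 1) * b\<close>. The disjunct for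
  \<open>b = 0\<close> makes the search terminate with the conventional value \<open>0\<close>.
\<close>
lemma computable_div [computability]:
  assumes "computable_in A f" "computable_in A g"
  shows "computable_in A (\<lambda>x. f x div g x)"
proof -
  have *: "a div b = (LEAST q. b = 0 \<and> q = 0 \<or> a < Suc q * b)" for a b :: nat
  proof (rule Least_equality[symmetric])
    show "b = 0 \<and> a div b = 0 \<or> a < Suc (a div b) * b"
      by (metis dividend_less_div_times div_by_0 mult_Suc neq0_conv)
    show "a div b \<le> y" if "b = 0 \<and> y = 0 \<or> a < Suc y * b" for y
      using that by (auto simp: less_mult_imp_div_less simp flip: less_Suc_eq_le)
  qed
  have "\<exists>q. b = 0 \<and> q = 0 \<or> a < Suc q * b" for a b :: nat
    by (metis dividend_less_div_times mult_Suc neq0_conv)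
  then show ?thesis unfolding *
    using assms by (intro computable_Least computability computable_comp[OF assms(1)] computable_comp[OF assms(2)])
qed

lemma computable_mod [computability]:
  assumes "computable_in A f" "computable_in A g"
  shows "computable_in A (\<lambda>x. f x mod g x)"
  unfolding modulo_nat_def using assms by (intro computability)

section \<open>Stagewise approximation of partial recursive functions\<close>

text \<open>
  Replacing every oracle query by the constant \<open>0\<close> simulates the empty oracle.
\<close>
lemma computable_oracle_free:
  assumes "computable_in no_oracle f" shows "computable_in A f"
proof -
  define strip where "strip = rec_prog Zero Succ Fst Snd Zero (\<lambda>_ _. Tuple) (\<lambda>_ _. Comp) (\<lambda>_ _. PrimRec) (\<lambda>_. Minimize)"
  have "run A (strip p) = run no_oracle p" for p
    by (induction p) (simp_all add: strip_def cong: if_cong)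
  then show ?thesis using assms unfolding computable_in_def by metis
qed

text \<open>
  \<open>T x t\<close> is \<open>0\<close> as long as no output has been found by stage \<open>t\<close>, and \<open>Suc v\<close> once the output \<open>v\<close>
  has been found. The approximation is total and never retracts a value, which makes it possible to run
  several computations in parallel by taking the maximum of their stages.
\<close>
definition stage_approx :: "cantor \<Rightarrow> (nat \<Rightarrow> nat option) \<Rightarrow> (nat \<Rightarrow> nat \<Rightarrow> nat) \<Rightarrow> bool" where
  "stage_approx A \<phi> T \<longleftrightarrow> computable2 A T \<and>
     (\<forall>x s t v. T x s = Suc v \<longrightarrow> s \<le> t \<longrightarrow> T x t = Suc v) \<and>
     (\<forall>x v. \<phi> x = Some v \<longleftrightarrow> (\<exists>t. T x t = Suc v))"

lemma stage_approx_total: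
  assumes "computable_in A f" "\<And>x. \<phi> x = Some (f x)"
  shows "stage_approx A \<phi> (\<lambda>x t. Suc (f x))"
  unfolding stage_approx_def using assms(2) by (auto intro!: computability computable_comp[OF assms(1)])

lemma stage_approxD:
  assumes "stage_approx A \<phi> T"
  shows "computable2 A T" "T x s = Suc v \<Longrightarrow> s \<le> t \<Longrightarrow> T x t = Suc v"
    "\<phi> x = Some v \<longleftrightarrow> (\<exists>t. T x t = Suc v)"
  using assms unfolding stage_approx_def by blast+

lemma stage_approx_Tuple:
  assumes "stage_approx A \<phi> S" "stage_approx A \<psi> T"
  shows "stage_approx A (\<lambda>x. Option.bind (\<phi> x) (\<lambda>a. Option.bind (\<psi> x) (\<lambda>b. Some (prod_encode (a, b)))))
    (\<lambda>x t. if S x t = 0 \<or> T x t = 0 then 0 else Suc (prod_encode (S x t - 1, T x t - 1)))"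
    (is "stage_approx A ?\<rho> ?R")
  unfolding stage_approx_def
proof (intro conjI allI impI)
  note S = stage_approxD[OF assms(1)] and T = stage_approxD[OF assms(2)]
  show "computable2 A ?R" by (intro computability computable_comp2[OF S(1)] computable_comp2[OF T(1)])
  show mono: "?R x t = Suc v" if R: "?R x s = Suc v" and "s \<le> t" for x s t v
  proof -
    obtain a b where ab: "S x s = Suc a" "T x s = Suc b"
      using R by (cases "S x s"; cases "T x s") auto
    from S(2)[OF ab(1) \<open>s \<le> t\<close>] T(2)[OF ab(2) \<open>s \<le> t\<close>] R ab show ?thesis by simp
  qed
  show "?\<rho> x = Some v \<longleftrightarrow> (\<exists>t. ?R x t = Suc v)" for x v
  proof
    assume "?\<rho> x = Some v"
    then obtain a b where ab: "\<phi> x = Some a" "\<psi> x = Some b" "v = prod_encode (a, b)"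
      by (auto simp: bind_eq_Some_conv)
    then obtain s t where st: "S x s = Suc a" "T x t = Suc b" using S(3) T(3) by blast
    have "S x (max s t) = Suc a" "T x (max s t) = Suc b"
      by (rule S(2)[OF st(1)] T(2)[OF st(2)], simp)+
    then show "\<exists>t. ?R x t = Suc v" using ab(3) by (intro exI[of _ "max s t"]) simp
  next
    assume "\<exists>t. ?R x t = Suc v"
    then obtain t where t: "?R x t = Suc v" ..
    then obtain a b where ab: "S x t = Suc a" "T x t = Suc b"
      by (cases "S x t"; cases "T x t") auto
    then have "\<phi> x = Some a" "\<psi> x = Some b" using S(3) T(3) by blast+
    then show "?\<rho> x = Some v" using t ab by simp
  qed
qed

lemma stage_approx_Comp:
  assumes "stage_approx A \<phi> S" "stage_approx A \<psi> T"
  shows "stage_approx A (\<lambda>x. Option.bind (\<psi> x) \<phi>)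
    (\<lambda>x t. if T x t = 0 then 0 else S (T x t - 1) t)"
    (is "stage_approx A ?\<rho> ?R")
  unfolding stage_approx_def
proof (intro conjI allI impI)
  note S = stage_approxD[OF assms(1)] and T = stage_approxD[OF assms(2)]
  show "computable2 A ?R" by (intro computability computable_comp2[OF S(1)] computable_comp2[OF T(1)])
  show "?R x t = Suc v" if R: "?R x s = Suc v" and "s \<le> t" for x s t v
  proof -
    obtain b where b: "T x s = Suc b"
      using R by (cases "T x s") auto
    then have "S b s = Suc v" using R by simp
    from S(2)[OF this \<open>s \<le> t\<close>] T(2)[OF b \<open>s \<le> t\<close>] show ?thesis by simp
  qed
  show "?\<rho> x = Some v \<longleftrightarrow> (\<exists>t. ?R x t = Suc v)" for x v
  proof
    assume "?\<rho> x = Some v"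
    then obtain b where ab: "\<psi> x = Some b" "\<phi> b = Some v"
      by (auto simp: bind_eq_Some_conv)
    then obtain s t where st: "S b s = Suc v" "T x t = Suc b" using S(3) T(3) by blast
    have "S b (max s t) = Suc v" "T x (max s t) = Suc b"
      by (rule S(2)[OF st(1)] T(2)[OF st(2)], simp)+
    then show "\<exists>t. ?R x t = Suc v" by (intro exI[of _ "max s t"]) simp
  next
    assume "\<exists>t. ?R x t = Suc v"
    then obtain t where t: "?R x t = Suc v" ..
    then obtain b where b: "T x t = Suc b"
      by (cases "T x t") auto
    then have "\<psi> x = Some b" "\<phi> b = Some v" using S(3) T(3) t by auto
    then show "?\<rho> x = Some v" by simp
  qed
qed

lemma stage_approx_PrimRec:
  assumes "stage_approx A \<phi> S" "stage_approx A \<psi> T"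
  shows "stage_approx A (\<lambda>x. case prod_decode x of (a, n) \<Rightarrow>
       rec_nat (\<phi> a) (\<lambda>m r. Option.bind r (\<lambda>v. \<psi> (prod_encode (a, prod_encode (m, v))))) n)
    (\<lambda>x t. rec_nat (S (p1 x) t)
       (\<lambda>m r. if r = 0 then 0 else T (prod_encode (p1 x, prod_encode (m, r - 1))) t) (p2 x))"
proof -
  note S = stage_approxD[OF assms(1)] and T = stage_approxD[OF assms(2)]
  define R where "R a n t = rec_nat (S a t)
       (\<lambda>m r. if r = 0 then 0 else T (prod_encode (a, prod_encode (m, r - 1))) t) n" for a n t
  define \<rho> where "\<rho> a n = rec_nat (\<phi> a)
       (\<lambda>m r. Option.bind r (\<lambda>v. \<psi> (prod_encode (a, prod_encode (m, v))))) n" for a n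
  have R0: "R a 0 t = S a t" and RS: "R a (Suc n) t =
     (if R a n t = 0 then 0 else T (prod_encode (a, prod_encode (n, R a n t - 1))) t)" for a n t
    by (simp_all add: R_def)
  have X0: "\<rho> a 0 = \<phi> a"
    and XS: "\<rho> a (Suc n) = Option.bind (\<rho> a n) (\<lambda>v. \<psi> (prod_encode (a, prod_encode (n, v))))" for a n
    by (simp_all add: \<rho>_def)
  have mono: "R a n s = Suc v \<Longrightarrow> s \<le> t \<Longrightarrow> R a n t = Suc v" for a n s t v
  proof (induction n arbitrary: v)
    case 0 then show ?case unfolding R0 by (rule S(2))
  next
    case (Suc n)
    obtain b where b: "R a n s = Suc b"
      using Suc.prems(1) unfolding RS by (cases "R a n s") auto
    then have "T (prod_encode (a, prod_encode (n, b))) s = Suc v" using Suc.prems(1) by (simp add: RS)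
    from T(2)[OF this Suc.prems(2)] Suc.IH[OF b Suc.prems(2)] show ?case by (simp add: RS)
  qed
  have iff: "\<rho> a n = Some v \<longleftrightarrow> (\<exists>t. R a n t = Suc v)" for a n v
  proof (induction n arbitrary: v)
    case 0 then show ?case using S(3) by (simp add: R0 X0)
  next
    case (Suc n)
    show ?case
    proof
      assume "\<rho> a (Suc n) = Some v"
      then obtain b where ab: "\<rho> a n = Some b" "\<psi> (prod_encode (a, prod_encode (n, b))) = Some v"
        by (auto simp: bind_eq_Some_conv XS)
      then obtain s t where st: "T (prod_encode (a, prod_encode (n, b))) s = Suc v" "R a n t = Suc b"
        using T(3) Suc.IH by blast
      have "T (prod_encode (a, prod_encode (n, b))) (max s t) = Suc v" "R a n (max s t) = Suc b"
        by (rule T(2)[OF st(1)] mono[OF st(2)], simp)+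
      then show "\<exists>t. R a (Suc n) t = Suc v" by (intro exI[of _ "max s t"]) (simp add: RS)
    next
      assume "\<exists>t. R a (Suc n) t = Suc v"
      then obtain t where t: "R a (Suc n) t = Suc v" ..
      then obtain b where b: "R a n t = Suc b"
        unfolding RS by (cases "R a n t") auto
      then have "\<rho> a n = Some b" "\<psi> (prod_encode (a, prod_encode (n, b))) = Some v"
        using Suc.IH T(3) t by (auto simp: RS)
      then show "\<rho> a (Suc n) = Some v" by (simp add: XS)
    qed
  qed
  have cR: "computable2 A (\<lambda>x t. R (p1 x) (p2 x) t)"
    unfolding R_def by (intro computability computable_comp2[OF S(1)] computable_comp2[OF T(1)])
  have "stage_approx A (\<lambda>x. \<rho> (p1 x) (p2 x)) (\<lambda>x t. R (p1 x) (p2 x) t)"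
    unfolding stage_approx_def using cR mono iff by blast
  then show ?thesis by (simp add: R_def \<rho>_def case_prod_beta')
qed

text \<open>
  At stage \<open>t\<close> the search stops at \<open>t\<close> or at the first \<open>n\<close> for which \<open>\<phi> (x, n)\<close> is undefined so far or
  is \<open>0\<close>, that is, whose approximation is below \<open>2\<close>. All smaller arguments have then been seen to yield
  positive values, so the minimum has been found if the approximation is \<open>1\<close>, which codes the value \<open>0\<close>.
\<close>
lemma stage_approx_Minimize:
  assumes "stage_approx A \<phi> S"
  shows "stage_approx A (\<lambda>x.
     if \<exists>n. \<phi> (prod_encode (x, n)) = Some 0 \<and> (\<forall>m<n. \<exists>v. \<phi> (prod_encode (x, m)) = Some (Suc v))
     then Some (LEAST n. \<phi> (prod_encode (x, n)) = Some 0) else None)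
    (\<lambda>x t. let n = (LEAST n. n = t \<or> S (prod_encode (x, n)) t < 2) in
       if S (prod_encode (x, n)) t = 1 then Suc n else 0)"
    (is "stage_approx A ?\<rho> ?R")
proof -
  note S = stage_approxD[OF assms(1)]
  define N where "N x t = (LEAST n. n = t \<or> S (prod_encode (x, n)) t < 2)" for x t
  define good where "good x v \<longleftrightarrow> \<phi> (prod_encode (x, v)) = Some 0 \<and>
      (\<forall>m<v. \<exists>w. \<phi> (prod_encode (x, m)) = Some (Suc w))" for x v
  have cN: "computable2 A N" unfolding N_def
    by (rule computable_Least, intro computability computable_comp2[OF S(1)]) blast
  have cR: "computable2 A ?R" unfolding Let_def N_def[symmetric]
    by (intro computability computable_comp2[OF S(1)] computable_comp2[OF cN])
  have chi: "?\<rho> x = Some v \<longleftrightarrow> good x v" for x v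
  proof -
    have least: "(LEAST n. \<phi> (prod_encode (x, n)) = Some 0) = n" if "good x n" for n
      using that unfolding good_def by (intro Least_equality) (auto simp: not_le[symmetric] dest: leI)
    show ?thesis
      using least unfolding good_def by (auto split: if_splits)
  qed
  have R: "?R x t = Suc v \<longleftrightarrow> S (prod_encode (x, v)) t = 1 \<and> v \<le> t \<and> (\<forall>m<v. S (prod_encode (x, m)) t \<ge> 2)" for x t v
  proof
    assume "?R x t = Suc v"
    then have v: "v = N x t" "S (prod_encode (x, v)) t = 1" by (auto simp: N_def Let_def split: if_splits)
    have "v \<le> t" unfolding v(1) N_def by (rule Least_le) simp
    moreover have "S (prod_encode (x, m)) t \<ge> 2" if "m < v" for m
      using not_less_Least[OF that[unfolded v(1) N_def]] by simp
    ultimately show "S (prod_encode (x, v)) t = 1 \<and> v \<le> t \<and> (\<forall>m<v. S (prod_encode (x, m)) t \<ge> 2)"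
      using v(2) by blast
  next
    assume *: "S (prod_encode (x, v)) t = 1 \<and> v \<le> t \<and> (\<forall>m<v. S (prod_encode (x, m)) t \<ge> 2)"
    then have "N x t = v" unfolding N_def
      by (intro Least_equality) (auto simp: not_less[symmetric])
    then show "?R x t = Suc v" using * by (simp add: N_def Let_def)
  qed
  have mono: "?R x t = Suc v" if "?R x s = Suc v" "s \<le> t" for x s t v
  proof -
    from that(1) have *: "S (prod_encode (x, v)) s = 1" "v \<le> s" "\<And>m. m < v \<Longrightarrow> S (prod_encode (x, m)) s \<ge> 2"
      unfolding R by auto
    have "S (prod_encode (x, m)) t \<ge> 2" if m: "m < v" for m
    proof -
      obtain w where w: "S (prod_encode (x, m)) s = Suc w" using *(3)[OF m] by (cases "S (prod_encode (x, m)) s") auto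
      from S(2)[OF this \<open>s \<le> t\<close>] w *(3)[OF m] show ?thesis by simp
    qed
    then show ?thesis unfolding R using S(2)[of _ s 0 t] * that(2) by auto
  qed
  have conv: "good x v \<longleftrightarrow> (\<exists>t. ?R x t = Suc v)" for x v
  proof
    assume g: "good x v"
    have "\<forall>m\<in>{..v}. \<exists>t. \<exists>w. S (prod_encode (x, m)) t = Suc w \<and> (if m = v then w = 0 else w > 0)"
    proof
      fix m assume "m \<in> {..v}"
      then have "m = v \<or> m < v" by auto
      then show "\<exists>t. \<exists>w. S (prod_encode (x, m)) t = Suc w \<and> (if m = v then w = 0 else w > 0)"
        using g unfolding good_def S(3) by (metis less_irrefl zero_less_Suc)
    qed
    then obtain \<tau> where \<tau>: "\<And>m. m \<le> v \<Longrightarrow> \<exists>w. S (prod_encode (x, m)) (\<tau> m) = Suc w \<and> (if m = v then w = 0 else w > 0)"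
      unfolding atMost_iff Ball_def by metis
    define t where "t = Max (insert v (\<tau> ` {..v}))"
    have le: "v \<le> t" "\<And>m. m \<le> v \<Longrightarrow> \<tau> m \<le> t"
      unfolding t_def by (rule Max_ge; simp)+
    have "S (prod_encode (x, v)) t = 1" using \<tau>[of v] S(2)[OF _ le(2)[of v]] by auto
    moreover have "S (prod_encode (x, m)) t \<ge> 2" if m: "m < v" for m
      using \<tau>[of m] S(2)[OF _ le(2)[of m]] m by (auto split: if_splits)
    ultimately have "?R x t = Suc v" unfolding R using le by blast
    then show "\<exists>t. ?R x t = Suc v" ..
  next
    assume "\<exists>t. ?R x t = Suc v"
    then obtain t where t: "S (prod_encode (x, v)) t = Suc 0" "\<And>m. m < v \<Longrightarrow> S (prod_encode (x, m)) t \<ge> Suc (Suc 0)"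
      unfolding R by (auto simp: numeral_2_eq_2)
    have "\<exists>w t. S (prod_encode (x, m)) t = Suc (Suc w)" if "m < v" for m
      using le_Suc_ex[OF t(2)[OF that]] by auto
    then show "good x v" unfolding good_def S(3) using t(1) by blast
  qed
  show ?thesis unfolding stage_approx_def using cR mono chi conv by blast
qed

text \<open>
  The approximation is built separately for each program, by induction on its structure, with one
  construction for each of Kleene's schemata.
\<close>
lemma ex_stage_approx: "\<exists>T. stage_approx A (run A p) T"
proof (induction p)
  case Zero
  show ?case by (rule exI, rule stage_approx_total[of _ "\<lambda>x. 0"]) (simp_all add: computability)
next
  case Succ
  show ?case by (rule exI, rule stage_approx_total[of _ Suc]) (simp_all add: computability)
next
  case Fst
  show ?case by (rule exI, rule stage_approx_total[of _ p1]) (auto intro: computability)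
next
  case Snd
  show ?case by (rule exI, rule stage_approx_total[of _ p2]) (auto intro: computability)
next
  case Query
  show ?case by (rule exI, rule stage_approx_total[of _ "\<lambda>x. of_bool (A x)"]) (auto intro: computability computable_of_bool computable_query[OF computable_id])
next
  case (Tuple p q)
  then show ?case by (auto intro: stage_approx_Tuple)
next
  case (Comp p q)
  then show ?case by (auto intro: stage_approx_Comp)
next
  case (PrimRec p q)
  then show ?case unfolding run.simps by (blast intro: stage_approx_PrimRec)
next
  case (Minimize p)
  then show ?case unfolding run.simps by (blast intro: stage_approx_Minimize)
qed

lemma ce_inI:
  assumes "decidable2 A R"
  shows "ce_in A {x. \<exists>t. R x t}"
proof -
  have "computable2 A (\<lambda>x t. of_bool (\<not> R x t))" by (intro computability assms)
  then obtain p where p: "\<And>y. run A p y = Some (of_bool (\<not> R (p1 y) (p2 y)))"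
    unfolding computable_in_def by blast
  have "{x. \<exists>t. R x t} = {x. \<exists>n. R x n \<and> (\<forall>m<n. \<not> R x m)}"
    using exists_least_iff[of "R x" for x] by blast
  also have "\<dots> = dom (run A (Minimize p))" by (simp add: p dom_def) blast
  finally show ?thesis unfolding ce_in_def by blast
qed

lemma ce_inE:
  assumes "ce_in A W"
  obtains R where "decidable2 A R" "\<And>x s t. R x s \<Longrightarrow> s \<le> t \<Longrightarrow> R x t" "W = {x. \<exists>t. R x t}"
proof -
  obtain p where W: "W = dom (run A p)" using assms unfolding ce_in_def by blast
  obtain T where T: "stage_approx A (run A p) T" using ex_stage_approx by blast
  note T = stage_approxD[OF T]
  show ?thesis
  proof (rule that)
    show "decidable2 A (\<lambda>x t. 0 < T x t)" by (intro computability T(1))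
    show "0 < T x t" if "0 < T x s" "s \<le> t" for x s t
      using that T(2)[of x s _ t] by (metis gr0_conv_Suc)
    show "W = {x. \<exists>t. 0 < T x t}"
      unfolding W dom_def using T(3) by (auto simp: gr0_conv_Suc)
  qed
qed

section \<open>Effectively open sets in terms of binary prefixes\<close>

text \<open>
  The most significant bit comes first, so that \<open>val t X div 2 ^ s\<close> is the value of a shorter prefix and
  \<open>{X. val t X < v}\<close> is an initial segment of Cantor space in the lexicographic order.
\<close>
primrec val :: "nat \<Rightarrow> cantor \<Rightarrow> nat" where
  "val 0 X = 0"
| "val (Suc t) X = 2 * val t X + of_bool (X t)"

lemma val_less: "val t X < 2 ^ t"
  by (induction t) auto

lemma val_div: "val (t + s) X div 2 ^ s = val t X"
  by (induction s) (auto simp: div_mult2_eq)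

lemma val_div': "l \<le> t \<Longrightarrow> val t X div 2 ^ (t - l) = val l X"
  using val_div[of l "t - l" X] by simp

lemma val_digit: "i < t \<Longrightarrow> val t X div 2 ^ (t - Suc i) mod 2 = of_bool (X i)"
  using val_div'[of "Suc i" t X] by simp

lemma val_eq_iff: "val t X = val t Y \<longleftrightarrow> (\<forall>i<t. X i = Y i)"
proof
  show "\<forall>i<t. X i = Y i" if "val t X = val t Y"
    using val_digit[of _ t X] val_digit[of _ t Y] that by (metis of_bool_eq_iff)
  show "\<forall>i<t. X i = Y i \<Longrightarrow> val t X = val t Y"
    by (induction t) auto
qed

lemma val_surj:
  assumes "v < 2 ^ t" obtains X where "val t X = v"
proof -
  have "\<exists>X. val t X = v" using assms
  proof (induction t arbitrary: v)
    case (Suc t)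
    then obtain X where X: "val t X = v div 2" using less_mult_imp_div_less[of v "2^t" 2]
      by (metis power_Suc2)
    have "val t (X(t := odd v)) = val t X" by (simp add: val_eq_iff)
    then have "val (Suc t) (X(t := odd v)) = v" using X by (cases "odd v") auto
    then show ?case by (intro exI[of _ "X(t := odd v)"])
  qed simp
  then show ?thesis using that by blast
qed

text \<open>
  Computes the code of the string of length \<open>t\<close> with binary value \<open>v\<close>, consing the bits from right to left.
\<close>
definition prefix_code :: "nat \<Rightarrow> nat \<Rightarrow> nat" where
  "prefix_code t v = rec_nat 0 (\<lambda>j c. Suc (prod_encode (v div 2 ^ j mod 2, c))) t"

lemma prefix_code_val: "prefix_code t (val t X) = string_code (map X [0..<t])"
proof -
  have "rec_nat 0 (\<lambda>j c. Suc (prod_encode (val t X div 2 ^ j mod 2, c))) j = string_code (map X [t - j..<t])"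
    if "j \<le> t" for j
    using that
  proof (induction j)
    case 0 then show ?case by (simp add: string_code_def)
  next
    case (Suc j)
    then have "[t - Suc j..<t] = (t - Suc j) # [t - j..<t]"
      using upt_conv_Cons[of "t - Suc j" t] by (simp add: Suc_diff_Suc)
    moreover have "val t X div 2 ^ j mod 2 = of_bool (X (t - Suc j))"
      using val_digit[of "t - Suc j" t X] Suc.prems by (simp add: Suc_diff_Suc)
    ultimately show ?case using Suc by (simp add: string_code_def of_bool_def)
  qed
  from this[of t] show ?thesis by (simp add: prefix_code_def)
qed

lemma string_code_inj: "string_code s = string_code s' \<Longrightarrow> s = s'"
  unfolding string_code_def list_encode_eq
  by (rule map_injective[of "\<lambda>b. if b then 1 else 0"]) (auto simp: inj_def split: if_splits)

lemma cylinder_map: "cylinder (map X [0..<t]) = {Y. val t Y = val t X}"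
  by (auto simp: cylinder_def val_eq_iff)

text \<open>
  The witness \<open>z\<close> may inspect a prefix whose length depends on it. A string belongs to the enumeration
  if its length and its value are accepted by some \<open>z\<close>.
\<close>
lemma ce_openI:
  assumes R: "decidable3 A R" and l: "computable2 A l"
  shows "uniformly_ce_open_in A (\<lambda>n. {X. \<exists>z. R n z (val (l n z) X)})"
proof -
  define W where "W = {y. \<exists>u. p2 u < 2 ^ l (p1 y) (p1 u) \<and> p2 y = prefix_code (l (p1 y) (p1 u)) (p2 u) \<and> R (p1 y) (p1 u) (p2 u)}"
  have "ce_in A W"
    unfolding W_def prefix_code_def
    by (intro ce_inI computability computable_comp2[OF l] decidable_comp3[OF R])
  moreover have "{X. \<exists>z. R n z (val (l n z) X)} = (\<Union>s\<in>{s. prod_encode (n, string_code s) \<in> W}. cylinder s)" (is "?L = ?R") for n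
  proof (intro set_eqI iffI)
    fix X assume "X \<in> ?L"
    then obtain z where z: "R n z (val (l n z) X)" by blast
    let ?s = "map X [0..<l n z]"
    have "prod_encode (n, string_code ?s) \<in> W" unfolding W_def mem_Collect_eq
      by (rule exI[of _ "prod_encode (z, val (l n z) X)"]) (simp add: z val_less prefix_code_val)
    moreover have "X \<in> cylinder ?s" by (simp add: cylinder_map)
    ultimately show "X \<in> ?R" by blast
  next
    fix X assume "X \<in> ?R"
    then obtain s u where s: "X \<in> cylinder s" and u: "p2 u < 2 ^ l n (p1 u)"
      "string_code s = prefix_code (l n (p1 u)) (p2 u)" "R n (p1 u) (p2 u)"
      unfolding W_def by auto
    obtain Y where Y: "val (l n (p1 u)) Y = p2 u" using val_surj[OF u(1)] by blast
    have "s = map Y [0..<l n (p1 u)]" by (rule string_code_inj) (simp add: u(2) flip: Y prefix_code_val)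
    then have "val (l n (p1 u)) X = p2 u" using s Y by (simp add: cylinder_map)
    then show "X \<in> ?L" using u(3) by (auto intro!: exI[of _ "p1 u"])
  qed
  ultimately show ?thesis unfolding uniformly_ce_open_in_def by blast
qed

text \<open>
  \<open>P n t\<close> decides from the first \<open>t\<close> bits whether a point has been put into \<open>U n\<close> by stage \<open>t\<close>: the
  same \<open>t\<close> bounds the length of the prefix and the stage of the enumeration.
\<close>
definition open_stages :: "cantor \<Rightarrow> (nat \<Rightarrow> cantor set) \<Rightarrow> (nat \<Rightarrow> nat \<Rightarrow> nat \<Rightarrow> bool) \<Rightarrow> bool" where
  "open_stages A U P \<longleftrightarrow> decidable3 A P \<and>
     (\<forall>n s t X. P n s (val s X) \<longrightarrow> s \<le> t \<longrightarrow> P n t (val t X)) \<and>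
     (\<forall>n. U n = {X. \<exists>t. P n t (val t X)})"

lemma open_stagesD:
  assumes "open_stages A U P"
  shows "decidable3 A P" "P n s (val s X) \<Longrightarrow> s \<le> t \<Longrightarrow> P n t (val t X)"
    "U n = {X. \<exists>t. P n t (val t X)}"
  using assms unfolding open_stages_def by blast+

lemma ce_openE:
  assumes "uniformly_ce_open_in A U"
  obtains P where "open_stages A U P"
proof -
  obtain W where W: "ce_in A W" "\<And>n. U n = (\<Union>s\<in>{s. prod_encode (n, string_code s) \<in> W}. cylinder s)"
    using assms unfolding uniformly_ce_open_in_def by blast
  obtain R where R: "decidable2 A R" "\<And>x s t. R x s \<Longrightarrow> s \<le> t \<Longrightarrow> R x t" "W = {x. \<exists>t. R x t}"
    using ce_inE[OF W(1)] by blast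
  define P where "P n t w \<longleftrightarrow> (\<exists>l<Suc t. R (prod_encode (n, prefix_code l (w div 2 ^ (t - l)))) t)" for n t w
  have P: "P n t (val t X) \<longleftrightarrow> (\<exists>l\<le>t. R (prod_encode (n, string_code (map X [0..<l]))) t)" for n t X
    unfolding P_def less_Suc_eq_le by (auto simp: prefix_code_val val_div')
  have in_cyl: "X \<in> cylinder s \<longleftrightarrow> map X [0..<length s] = s" for X s
    unfolding cylinder_def list_eq_iff_nth_eq by auto
  show ?thesis
  proof (rule that, unfold open_stages_def, intro conjI allI impI)
    show "decidable3 A P" unfolding P_def prefix_code_def
      by (intro computability decidable_comp2[OF R(1)])
    show "P n t (val t X)" if "P n s (val s X)" "s \<le> t" for n s t X
      using that R(2) unfolding P by (meson le_trans)
    show "U n = {X. \<exists>t. P n t (val t X)}" for n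
    proof (intro set_eqI iffI)
      fix X assume "X \<in> U n"
      then obtain s t where s: "X \<in> cylinder s" "R (prod_encode (n, string_code s)) t" unfolding W R(3) by auto
      then have "R (prod_encode (n, string_code (map X [0..<length s]))) (max t (length s))"
        using R(2)[OF _ max.cobounded1] by (simp add: in_cyl)
      then have "P n (max t (length s)) (val (max t (length s)) X)" unfolding P by (intro exI[of _ "length s"]) simp
      then show "X \<in> {X. \<exists>t. P n t (val t X)}" by blast
    next
      fix X assume "X \<in> {X. \<exists>t. P n t (val t X)}"
      then obtain l t where "R (prod_encode (n, string_code (map X [0..<l]))) t" unfolding P by blast
      then have "prod_encode (n, string_code (map X [0..<l])) \<in> W" unfolding R(3) by blast
      moreover have "X \<in> cylinder (map X [0..<l])" by (simp add: cylinder_map)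
      ultimately show "X \<in> U n" unfolding W(2) by blast
    qed
  qed
qed

section \<open>Measures of cylinders and of disjoint blocks\<close>

interpretation coords: product_prob_space "\<lambda>_. measure_pmf (bernoulli_pmf (1 / 2))" "UNIV :: nat set"
  by unfold_locales

interpretation cantor: prob_space cantor_measure
  unfolding cantor_measure_def by (rule coords.prob_space_axioms)

abbreviation \<mu> :: "cantor set \<Rightarrow> real" where "\<mu> \<equiv> measure cantor_measure"

lemma space_cantor [simp]: "space cantor_measure = UNIV"
  by (simp add: cantor_measure_def space_PiM)

lemma
  assumes "finite K"
  shows sets_coords: "{X. \<forall>i\<in>K. X i = b i} \<in> sets cantor_measure"
    and measure_coords: "\<mu> {X. \<forall>i\<in>K. X i = b i} = 1 / 2 ^ card K"
proof -
  let ?M = "\<lambda>_ :: nat. measure_pmf (bernoulli_pmf (1 / 2))"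
  have "{X. \<forall>i\<in>K. X i = b i} = {X\<in>space cantor_measure. \<forall>i\<in>K. X i \<in> {b i}}" by simp
  also have "\<dots> \<in> sets cantor_measure"
    unfolding cantor_measure_def using assms
    by (intro sets.sets_Collect_finite_All measurable_sets_Collect[OF measurable_component_singleton]) auto
  finally show "{X. \<forall>i\<in>K. X i = b i} \<in> sets cantor_measure" .
  have "emeasure cantor_measure {X\<in>space cantor_measure. \<forall>i\<in>K. X i \<in> {b i}} = (\<Prod>i\<in>K. emeasure (?M i) {b i})"
    unfolding cantor_measure_def by (rule coords.emeasure_PiM_Collect) (use assms in auto)
  also have "\<dots> = (\<Prod>i\<in>K. ennreal (1 / 2))"
  proof (rule prod.cong)
    show "emeasure (measure_pmf (bernoulli_pmf (1 / 2))) {b i} = ennreal (1 / 2)" for i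
      by (cases "b i") (simp_all add: emeasure_pmf_single)
  qed simp
  also have "\<dots> = ennreal (1 / 2) ^ card K" by (rule prod_constant)
  also have "\<dots> = ennreal ((1 / 2) ^ card K)" by (rule ennreal_power) simp
  also have "\<dots> = ennreal (1 / 2 ^ card K)" by (simp only: power_one_over)
  finally show "\<mu> {X. \<forall>i\<in>K. X i = b i} = 1 / 2 ^ card K"
    by (simp add: measure_def)
qed

lemma
  assumes "v < 2 ^ t"
  shows sets_val_eq: "{X. val t X = v} \<in> sets cantor_measure"
    and measure_val_eq: "\<mu> {X. val t X = v} = 1 / 2 ^ t"
proof -
  obtain Y where Y: "val t Y = v" using val_surj[OF assms] .
  have *: "{X. val t X = v} = {X. \<forall>i\<in>{..<t}. X i = Y i}"
    unfolding Y[symmetric] val_eq_iff by auto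
  show "{X. val t X = v} \<in> sets cantor_measure" unfolding * by (rule sets_coords) simp
  show "\<mu> {X. val t X = v} = 1 / 2 ^ t" unfolding * by (subst measure_coords) simp_all
qed

lemma val_Collect: "{X. P (val t X)} = (\<Union>v\<in>{v. v < 2 ^ t \<and> P v}. {X. val t X = v})"
  using val_less by auto

lemma sets_val: "{X. P (val t X)} \<in> sets cantor_measure"
  unfolding val_Collect by (rule sets.finite_UN) (auto intro: sets_val_eq)

lemma sets_ex_val: "{X. \<exists>z :: nat. R z (val (l z) X)} \<in> sets cantor_measure"
proof -
  have "{X. \<exists>z :: nat. R z (val (l z) X)} = (\<Union>z. {X. R z (val (l z) X)})" by auto
  also have "\<dots> \<in> sets cantor_measure" using sets_val by (intro sets.countable_UN) blast
  finally show ?thesis .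
qed

text \<open>
  All measures below are computed through this formula, whose right-hand side is a computable sum.
\<close>
lemma measure_val: "\<mu> {X. P (val t X)} = real (\<Sum>v<2 ^ t. of_bool (P v)) / 2 ^ t"
proof -
  have "\<mu> {X. P (val t X)} = (\<Sum>v\<in>{v. v < 2 ^ t \<and> P v}. \<mu> {X. val t X = v})"
    unfolding val_Collect by (rule measure_finite_Union) (auto simp: disjoint_family_on_def intro: sets_val_eq)
  also have "\<dots> = (\<Sum>v\<in>{v. v < 2 ^ t \<and> P v}. 1 / 2 ^ t)"
    by (intro sum.cong) (auto simp: measure_val_eq)
  also have "\<dots> = real (card ({..<2 ^ t} \<inter> {v. P v})) / 2 ^ t"
    by (simp add: Int_def lessThan_def)
  also have "card ({..<2 ^ t} \<inter> {v. P v}) = (\<Sum>v<2 ^ t. of_bool (P v))"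
    by (simp add: sum_of_bool_eq)
  finally show ?thesis .
qed

lemma sets_zeros: "finite K \<Longrightarrow> {X :: cantor. \<forall>i\<in>K. \<not> X i} \<in> sets cantor_measure"
  and measure_zeros: "finite K \<Longrightarrow> \<mu> {X. \<forall>i\<in>K. \<not> X i} = 1 / 2 ^ card K"
  using sets_coords[of K "\<lambda>_. False"] measure_coords[of K "\<lambda>_. False"] by simp_all

text \<open>
  Independence of events determined by disjoint sets of coordinates. The additional constraint that
  \<open>X\<close> vanishes on \<open>K\<close> makes the statement inductive: avoiding one more block is the
  difference between no constraint on it and the constraint that \<open>X\<close> vanishes on it.
\<close>
lemma measure_avoid_blocks:
  assumes "finite F" "finite K" "\<And>c. c \<in> F \<Longrightarrow> finite (I c)" "disjoint_family_on I F"
    "\<And>c. c \<in> F \<Longrightarrow> I c \<inter> K = {}"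
  shows "\<mu> {X. (\<forall>i\<in>K. \<not> X i) \<and> (\<forall>c\<in>F. \<exists>i\<in>I c. X i)} = (\<Prod>c\<in>F. 1 - 1 / 2 ^ card (I c)) / 2 ^ card K"
  using assms
proof (induction F arbitrary: K rule: finite_induct)
  case empty
  then show ?case using measure_zeros by simp
next
  case (insert c F)
  let ?S = "\<lambda>K. {X. (\<forall>i\<in>K. \<not> X i) \<and> (\<forall>c\<in>F. \<exists>i\<in>I c. X i)}"
  have meas: "?S K \<in> sets cantor_measure" if "finite K" for K
  proof -
    have "?S K = {X. \<forall>i\<in>K. \<not> X i} \<inter> (UNIV - (\<Union>c\<in>F. {X. \<forall>i\<in>I c. \<not> X i}))" by auto
    also have "\<dots> \<in> sets cantor_measure"
      using that insert.prems insert.hyps(1) space_cantor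
      by (intro sets.Int sets_zeros sets.Diff sets.finite_UN) (auto simp flip: space_cantor)
    finally show ?thesis .
  qed
  have disj: "disjoint_family_on I F" "\<And>d. d \<in> F \<Longrightarrow> I c \<inter> I d = {}"
    using insert.prems(3) insert.hyps(2) by (auto simp: disjoint_family_on_def)
  have IH: "\<mu> (?S K') = (\<Prod>c\<in>F. 1 - 1 / 2 ^ card (I c)) / 2 ^ card K'"
    if "finite K'" "\<And>d. d \<in> F \<Longrightarrow> I d \<inter> K' = {}" for K'
    using insert.IH[OF that(1)] insert.prems(2) disj(1) that(2) by auto
  have fin: "finite (K \<union> I c)" using insert.prems by auto
  have "{X. (\<forall>i\<in>K. \<not> X i) \<and> (\<forall>d\<in>insert c F. \<exists>i\<in>I d. X i)} = ?S K - ?S (K \<union> I c)" by auto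
  also have "\<mu> \<dots> = \<mu> (?S K) - \<mu> (?S (K \<union> I c))"
    by (rule cantor.finite_measure_Diff) (use meas fin insert.prems(1) in auto)
  also have "\<mu> (?S K) = (\<Prod>c\<in>F. 1 - 1 / 2 ^ card (I c)) / 2 ^ card K"
    using insert.prems by (intro IH) auto
  also have "\<mu> (?S (K \<union> I c)) = (\<Prod>c\<in>F. 1 - 1 / 2 ^ card (I c)) / 2 ^ card (K \<union> I c)"
    using fin insert.prems(4) disj(2) by (intro IH) (auto simp: Int_commute Int_Un_distrib)
  also have "card (K \<union> I c) = card K + card (I c)"
    using insert.prems by (intro card_Un_disjoint) (auto simp: Int_commute)
  finally show ?case using insert.hyps by (simp add: field_simps power_add)
qed

section \<open>Summable left-c.e. bounds imply lowness\<close>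

lemma int_decode_eq: "int_decode n = (if n mod 2 = 0 then int (n div 2) else - int (n div 2) - 1)"
  by (simp add: int_decode_def sum_decode_def even_iff_mod_2_eq_zero)

lemma real_of_code: "real_of_rat (rat_of_code c) = real_of_int (int_decode (p1 c)) / real (Suc (p2 c))"
  by (simp add: rat_of_code_def case_prod_beta of_rat_divide del: of_nat_Suc)

definition dyadic_code :: "nat \<Rightarrow> nat \<Rightarrow> nat" where
  "dyadic_code a t = prod_encode (2 * a, 2 ^ t - 1)"

lemma real_of_dyadic_code: "real_of_rat (rat_of_code (dyadic_code a t)) = real a / 2 ^ t"
proof -
  have "Suc (2 ^ t - 1) = (2 ^ t :: nat)" by simp
  then show ?thesis unfolding real_of_code dyadic_code_def int_decode_eq
    by (simp del: of_nat_Suc Suc_pred' Suc_diff_1)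
qed

lemma computable_dyadic_code [computability]:
  assumes "computable_in A f" "computable_in A g"
  shows "computable_in A (\<lambda>x. dyadic_code (f x) (g x))"
  unfolding dyadic_code_def by (intro computability assms)

text \<open>
  Comparing a coded rational with a positive dyadic one is decidable by integer arithmetic; odd codes of
  numerators denote negative numbers.
\<close>
lemma less_real_of_code:
  "1 / 2 ^ m < real_of_rat (rat_of_code c) \<longleftrightarrow> p1 c mod 2 = 0 \<and> Suc (p2 c) < (p1 c div 2) * 2 ^ m"
proof -
  have "real_of_int (int_decode (p1 c)) \<le> 0" if "p1 c mod 2 \<noteq> 0"
    using that by (simp add: int_decode_eq)
  then have neg: "\<not> 1 / 2 ^ m < real_of_rat (rat_of_code c)" if "p1 c mod 2 \<noteq> 0"
    using that unfolding real_of_code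
    by (simp add: not_less order_trans[OF divide_nonpos_nonneg])
  have "1 / 2 ^ m < real a / real b \<longleftrightarrow> b < a * 2 ^ m" if "b > 0" for a b
  proof -
    have "1 / 2 ^ m < real a / real b \<longleftrightarrow> real b < real (a * 2 ^ m)" using that by (simp add: field_simps)
    then show ?thesis by (simp only: of_nat_less_iff)
  qed
  note pos = this[of "Suc (p2 c)" "p1 c div 2", OF zero_less_Suc]
  show ?thesis
  proof (cases "p1 c mod 2 = 0")
    case True
    then have "real_of_rat (rat_of_code c) = real (p1 c div 2) / real (Suc (p2 c))"
      unfolding real_of_code int_decode_eq by simp
    then show ?thesis using pos True by simp
  qed (use neg in blast)
qed

lemma sums_prod_encode:
  fixes f :: "nat \<Rightarrow> real"
  assumes "\<And>c. 0 \<le> f c" "\<And>n. (\<lambda>d. f (prod_encode (n, d))) sums a n" "a sums s"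
  shows "f sums s"
proof -
  have a: "0 \<le> a n" for n by (rule sums_le[OF _ sums_zero assms(2)]) (rule assms(1))
  have 1: "((\<lambda>d. f (prod_encode (n, d))) has_sum a n) UNIV" for n
    using assms(1,2) by (intro sums_nonneg_imp_has_sum) auto
  have 2: "(a has_sum s) UNIV" using assms(3) a by (intro sums_nonneg_imp_has_sum) auto
  have "((\<lambda>x. f (prod_encode x)) has_sum s) (UNIV \<times> UNIV)"
    using 1 2 assms(1) by (intro has_sum_SigmaI[where g = a] summable_on_SigmaI[where g = a])
      (auto simp: summable_on_def)
  then have "(f has_sum s) UNIV"
    using has_sum_reindex_bij_betw[OF bij_prod_encode, of f s] by simp
  then show ?thesis by (rule has_sum_imp_sums)
qed

abbreviation len :: "nat \<Rightarrow> nat" where "len c \<equiv> p1 (p2 c)"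
abbreviation wrd :: "nat \<Rightarrow> nat" where "wrd c \<equiv> p2 (p2 c)"

text \<open>
  The cylinder coded by \<open>c\<close> has label \<open>p1 c\<close>, length \<open>len c\<close> and value \<open>wrd c\<close>. The label separates the
  components of the test, so that a point in all components lies in infinitely many cylinders of full weight.
\<close>
lemma Schnorr_weights:
  assumes "Schnorr_test_in A U"
  obtains f where "\<forall>c. 0 \<le> f c" "computable_real_fun_in A f" "f sums 2"
    "\<forall>X n. X \<in> U n \<longrightarrow> (\<exists>c. p1 c = n \<and> val (len c) X = wrd c \<and> f c = 1 / 2 ^ len c)"
proof -
  have "uniformly_ce_open_in A U" using assms unfolding Schnorr_test_in_def by blast
  from ce_openE[OF this] obtain P where "open_stages A U P" .
  note P = open_stagesD(1)[OF this] and mono = open_stagesD(2)[OF this] and U = open_stagesD(3)[OF this]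
  have \<mu>U: "\<mu> (U n) = 1 / 2 ^ n" for n using assms unfolding Schnorr_test_in_def by blast
  \<comment> \<open>the string with length \<open>t\<close> and value \<open>v\<close> is accepted, but its longest proper prefix is not\<close>
  define new where "new n t v \<longleftrightarrow> v < 2 ^ t \<and> P n t v \<and> \<not> (0 < t \<and> P n (t - 1) (v div 2))" for n t v
  have new: "new n t (val t X) \<longleftrightarrow> P n t (val t X) \<and> (\<forall>s<t. \<not> P n s (val s X))" for n t X
  proof (cases t)
    case 0 then show ?thesis by (simp add: new_def)
  next
    case (Suc r)
    have "val t X div 2 = val r X" using Suc by simp
    moreover have "\<not> P n r (val r X) \<longleftrightarrow> (\<forall>s<t. \<not> P n s (val s X))"
      using mono[of n _ X r] Suc by (auto simp: less_Suc_eq_le)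
    ultimately show ?thesis using Suc val_less[of t X] by (simp add: new_def del: val.simps)
  qed
  define f :: "nat \<Rightarrow> real" where "f c = (if new (p1 c) (len c) (wrd c) then 1 / 2 ^ len c else 0)" for c
  define E where "E c = {X. val (len c) X = wrd c \<and> new (p1 c) (len c) (wrd c)}" for c
  have E_sets: "E c \<in> sets cantor_measure" and \<mu>E: "\<mu> (E c) = f c" for c
  proof -
    show "E c \<in> sets cantor_measure"
      using sets_val[of "\<lambda>v. v = wrd c \<and> new (p1 c) (len c) (wrd c)" "len c"] by (simp only: E_def)
    show "\<mu> (E c) = f c"
    proof (cases "new (p1 c) (len c) (wrd c)")
      case True
      then have "wrd c < 2 ^ len c" by (simp add: new_def)
      then show ?thesis using True measure_val_eq by (simp add: E_def f_def)
    qed (simp add: E_def f_def)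
  qed
  have f_sum: "(\<lambda>d. f (prod_encode (n, d))) sums (1 / 2 ^ n)" for n
  proof -
    have "(\<Union>d. E (prod_encode (n, d))) = U n"
    proof (intro set_eqI iffI)
      fix X assume "X \<in> U n"
      then obtain t where "P n t (val t X)" unfolding U by blast
      then obtain t where "P n t (val t X)" "\<forall>s<t. \<not> P n s (val s X)"
        using exists_least_iff[of "\<lambda>t. P n t (val t X)"] by blast
      then have "X \<in> E (prod_encode (n, prod_encode (t, val t X)))" by (simp add: E_def new)
      then show "X \<in> (\<Union>d. E (prod_encode (n, d)))" by blast
    next
      fix X assume "X \<in> (\<Union>d. E (prod_encode (n, d)))"
      then obtain d where "val (p1 d) X = p2 d" "new n (p1 d) (p2 d)" by (auto simp: E_def)
      then have "P n (p1 d) (val (p1 d) X)" by (simp add: new_def)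
      then show "X \<in> U n" unfolding U by blast
    qed
    moreover have "disjoint_family (\<lambda>d. E (prod_encode (n, d)))"
    proof (unfold disjoint_family_on_def, intro ballI impI, rule ccontr)
      fix d e :: nat assume "d \<noteq> e" "E (prod_encode (n, d)) \<inter> E (prod_encode (n, e)) \<noteq> {}"
      then obtain X where d: "val (p1 d) X = p2 d" "new n (p1 d) (val (p1 d) X)"
        and e: "val (p1 e) X = p2 e" "new n (p1 e) (val (p1 e) X)" by (auto simp: E_def)
      then have "p1 d = p1 e" unfolding new by (metis linorder_neqE_nat)
      then have "prod_decode d = prod_decode e" using d e by (simp add: prod_eq_iff)
      then show False using \<open>d \<noteq> e\<close> by (metis prod_decode_inverse)
    qed
    ultimately show ?thesis
      using cantor.finite_measure_UNION[of "\<lambda>d. E (prod_encode (n, d))"] E_sets \<mu>E \<mu>U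
      by (auto simp: image_subset_iff)
  qed
  show ?thesis
  proof (rule that; (intro allI impI)?)
    show nonneg: "0 \<le> f c" for c by (simp add: f_def)
    define h where "h c = dyadic_code (of_bool (new (p1 c) (len c) (wrd c))) (len c)" for c
    have "computable_in A (\<lambda>y. h (p1 y))" unfolding h_def new_def
      by (intro computability decidable_comp3[OF P])
    moreover have "real_of_rat (rat_of_code (h c)) = f c" for c
      by (simp add: h_def f_def real_of_dyadic_code)
    ultimately show "computable_real_fun_in A f"
      unfolding computable_real_fun_in_def computable_rat_array_in_def
      by (intro exI[of _ "\<lambda>c k. rat_of_code (h c)"] conjI exI[of _ "\<lambda>y. h (p1 y)"]) auto
    show "f sums 2"
      by (rule sums_prod_encode[OF nonneg f_sum]) (use geometric_sums[of "1 / 2 :: real"] in \<open>simp add: power_one_over\<close>)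
    show "\<exists>c. p1 c = n \<and> val (len c) X = wrd c \<and> f c = 1 / 2 ^ len c" if "X \<in> U n" for X n
    proof -
      obtain t where "P n t (val t X)" using \<open>X \<in> U n\<close> unfolding U by blast
      then obtain t where "P n t (val t X)" "\<forall>s<t. \<not> P n s (val s X)"
        using exists_least_iff[of "\<lambda>t. P n t (val t X)"] by blast
      then show ?thesis by (intro exI[of _ "prod_encode (n, prod_encode (t, val t X))"]) (simp add: f_def new)
    qed
  qed
qed

text \<open>
  A cylinder is put on the list when \<open>g\<close> is seen to exceed half of its measure. The listed cylinders have total measure
  at most \<open>2 * (\<Sum>c. g c)\<close>, so the set of points lying in at least \<open>C * 2 ^ k\<close> of them
  has measure at most \<open>2 ^ - k\<close>. Halving leaves room to pass from the non-strict bound in the conclusion to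
  a strict one, which is semidecidable.
\<close>
lemma heavy_cylinders_test:
  assumes g: "\<And>c. 0 \<le> g c" "left_ce_fun g" "summable g"
  obtains V where "MartinLoef_test V"
    "\<forall>X k. infinite {c. val (len c) X = wrd c \<and> 1 / 2 ^ len c \<le> g c} \<longrightarrow> X \<in> V k"
proof -
  obtain h where h: "computable_in no_oracle h"
    and inc: "\<And>c. incseq (\<lambda>s. rat_of_code (h (prod_encode (c, s))))"
    and lim: "\<And>c. (\<lambda>s. real_of_rat (rat_of_code (h (prod_encode (c, s))))) \<longlonglongrightarrow> g c"
  proof -
    obtain q where q: "computable_rat_array_in no_oracle q"
      and "\<forall>n. incseq (q n) \<and> (\<lambda>k. real_of_rat (q n k)) \<longlonglongrightarrow> g n"
      using g(2) unfolding left_ce_fun_def by blast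
    moreover obtain h where "computable_in no_oracle h" "q = (\<lambda>n k. rat_of_code (h (prod_encode (n, k))))"
      using q unfolding computable_rat_array_in_def by blast
    ultimately show ?thesis using that by blast
  qed
  define q where "q c s = real_of_rat (rat_of_code (h (prod_encode (c, s))))" for c s
  have inc': "q c s \<le> q c t" if "s \<le> t" for c s t
    unfolding q_def using incseqD[OF inc that] by (simp add: of_rat_less_eq)
  have q_le: "q c s \<le> g c" for c s
    by (rule LIMSEQ_le_const[OF lim[of c]]) (use inc' in \<open>auto simp: q_def\<close>)
  define big where "big c s \<longleftrightarrow> 1 / 2 ^ Suc (len c) < q c s" for c s
  have dec_big: "decidable2 no_oracle big"
    unfolding big_def q_def less_real_of_code by (intro computability computable_comp[OF h])
  define D where "D c = {X. val (len c) X = wrd c \<and> (\<exists>s. big c s)}" for c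
  have D_sets: "D c \<in> sets cantor_measure" for c
    using sets_val[of "\<lambda>v. v = wrd c \<and> (\<exists>s. big c s)" "len c"] by (simp only: D_def)
  have \<mu>D: "\<mu> (D c) \<le> 2 * g c" for c
  proof (cases "wrd c < 2 ^ len c \<and> (\<exists>s. big c s)")
    case True
    then obtain s where "1 / 2 ^ Suc (len c) < q c s" unfolding big_def by blast
    then have "1 / 2 ^ Suc (len c) < g c" using q_le[of c s] by simp
    moreover have "\<mu> (D c) = 1 / 2 ^ len c" using True measure_val_eq by (simp add: D_def)
    ultimately show ?thesis by simp
  next
    case False
    then have "D c = {}" by (auto simp: D_def) (metis val_less)
    then show ?thesis using g(1) by simp
  qed
  \<comment> \<open>the successor keeps the threshold positive\<close>
  define C where "C = Suc (nat \<lceil>2 * (\<Sum>c. g c)\<rceil>)"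
  have C: "2 * (\<Sum>c. g c) \<le> real C" "0 < C" unfolding C_def by linarith+
  \<comment> \<open>number of listed cylinders found by stage \<open>s\<close> that contain the string of length \<open>s\<close> and value \<open>w\<close>\<close>
  define N where "N s w = (\<Sum>c<s. of_bool (len c \<le> s \<and> w div 2 ^ (s - len c) = wrd c \<and> big c s) :: nat)" for s w :: nat
  have N_val: "N s (val s X) = card {c. c < s \<and> len c \<le> s \<and> val (len c) X = wrd c \<and> big c s}" for s X
  proof -
    have "N s (val s X) = (\<Sum>c<s. of_bool (len c \<le> s \<and> val (len c) X = wrd c \<and> big c s) :: nat)"
      unfolding N_def by (intro sum.cong refl arg_cong[of _ _ of_bool]) (use val_div' in auto)
    then show ?thesis by (simp add: sum_of_bool_eq lessThan_def Int_def)
  qed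
  define V where "V k = {X. \<exists>s. C * 2 ^ k \<le> N s (val s X)}" for k
  show ?thesis
  proof (rule that; (intro allI impI)?)
    show "MartinLoef_test V" unfolding MartinLoef_test_def
    proof (intro conjI allI)
      show "decseq V"
      proof (rule decseq_SucI, unfold V_def, clarify)
        fix k X s assume "C * 2 ^ Suc k \<le> N s (val s X)"
        moreover have "C * 2 ^ k \<le> C * 2 ^ Suc k" by simp
        ultimately show "\<exists>s. C * 2 ^ k \<le> N s (val s X)" by (meson le_trans)
      qed
      show "uniformly_ce_open_in no_oracle V" unfolding V_def N_def
        by (intro ce_openI computability decidable_comp2[OF dec_big])
      fix k
      have V_sets: "V k \<in> sets cantor_measure" unfolding V_def by (rule sets_ex_val)
      define Z :: "cantor \<Rightarrow> ennreal" where "Z = (\<lambda>X. \<Sum>c. indicator (D c) X)"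
      have Z: "(\<Sum>c<s. indicator (D c) X) \<le> Z X" for s X
        unfolding Z_def by (intro sum_le_suminf) auto
      have meas [measurable]: "Z \<in> borel_measurable cantor_measure"
        unfolding Z_def by (rule borel_measurable_suminf_order, rule borel_measurable_indicator, rule D_sets)
      have sets_Collect_Z: "{X \<in> space cantor_measure. 1 \<le> ennreal (1 / (C * 2 ^ k)) * Z X} \<in> sets cantor_measure"
        by measurable
      have "V k \<subseteq> {X \<in> space cantor_measure. 1 \<le> ennreal (1 / (C * 2 ^ k)) * Z X}"
      proof (unfold V_def, clarify)
        fix X s assume *: "C * 2 ^ k \<le> N s (val s X)"
        have "ennreal (real (C * 2 ^ k)) \<le> ennreal (real (N s (val s X)))"
          using * by (intro ennreal_leI) (simp only: of_nat_le_iff)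
        also have "ennreal (real (N s (val s X))) = (\<Sum>c<s. of_bool (len c \<le> s \<and> val (len c) X = wrd c \<and> big c s))"
          unfolding N_val by (simp add: sum_of_bool_eq lessThan_def Int_def ennreal_of_nat_eq_real_of_nat)
        also have "\<dots> \<le> (\<Sum>c<s. indicator (D c) X)"
          by (intro sum_mono) (auto simp: D_def indicator_def)
        also have "\<dots> \<le> Z X" by (rule Z)
        finally have "ennreal (1 / (C * 2 ^ k)) * ennreal (real (C * 2 ^ k)) \<le> ennreal (1 / (C * 2 ^ k)) * Z X"
          by (rule mult_left_mono) simp
        moreover have "ennreal (1 / (C * 2 ^ k)) * ennreal (real (C * 2 ^ k)) = ennreal (1 / (C * 2 ^ k) * real (C * 2 ^ k))"
          by (rule ennreal_mult[symmetric]) auto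
        moreover have "1 / (C * 2 ^ k) * real (C * 2 ^ k) = 1" using C(2) by simp
        ultimately show "X \<in> space cantor_measure \<and> 1 \<le> ennreal (1 / (C * 2 ^ k)) * Z X" by simp
      qed
      then have sub: "emeasure cantor_measure (V k) \<le> emeasure cantor_measure {X \<in> space cantor_measure. 1 \<le> ennreal (1 / (C * 2 ^ k)) * Z X}"
        by (rule emeasure_mono) (rule sets_Collect_Z)
      have "(\<integral>\<^sup>+X. Z X \<partial>cantor_measure) = (\<Sum>c. \<integral>\<^sup>+X. indicator (D c) X \<partial>cantor_measure)"
        unfolding Z_def by (rule nn_integral_suminf, rule borel_measurable_indicator, rule D_sets)
      also have "\<dots> = (\<Sum>c. ennreal (\<mu> (D c)))"
        using D_sets by (simp add: cantor.emeasure_eq_measure)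
      also have "\<dots> \<le> (\<Sum>c. ennreal (2 * g c))" by (rule suminf_le, rule ennreal_leI, rule \<mu>D) simp_all
      also have "\<dots> = ennreal (\<Sum>c. 2 * g c)"
        using g by (intro suminf_ennreal2 summable_mult) auto
      also have "(\<Sum>c. 2 * g c) = 2 * (\<Sum>c. g c)" using g(3) by (rule suminf_mult)
      also have "ennreal (2 * (\<Sum>c. g c)) \<le> ennreal C" by (intro ennreal_leI C)
      finally have int: "(\<integral>\<^sup>+X. Z X \<partial>cantor_measure) \<le> ennreal C" .
      note sub
      also have "emeasure cantor_measure {X \<in> space cantor_measure. 1 \<le> ennreal (1 / (C * 2 ^ k)) * Z X} \<le>
          ennreal (1 / (C * 2 ^ k)) * (\<integral>\<^sup>+X. Z X * indicator (space cantor_measure) X \<partial>cantor_measure)"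
        using meas by (intro nn_integral_Markov_inequality sets.top) (simp add: space_cantor)
      also have "(\<integral>\<^sup>+X. Z X * indicator (space cantor_measure) X \<partial>cantor_measure) = (\<integral>\<^sup>+X. Z X \<partial>cantor_measure)"
        by simp
      also have "ennreal (1 / (C * 2 ^ k)) * (\<integral>\<^sup>+X. Z X \<partial>cantor_measure) \<le> ennreal (1 / (C * 2 ^ k)) * ennreal C"
        by (rule mult_left_mono[OF int]) simp
      also have "\<dots> = ennreal (1 / (C * 2 ^ k) * real C)" by (rule ennreal_mult[symmetric]) auto
      also have "1 / (C * 2 ^ k) * real C = 1 / 2 ^ k" using C(2) by simp
      finally show "\<mu> (V k) \<le> 1 / 2 ^ k" by (simp add: cantor.emeasure_eq_measure)
    qed
    show "X \<in> V k" if inf: "infinite {c. val (len c) X = wrd c \<and> 1 / 2 ^ len c \<le> g c}" for X k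
    proof -
      \<comment> \<open>\<open>C * 2 ^ k\<close> cylinders suffice, and finitely many of them are all listed by a common stage\<close>
      obtain F where F: "finite F" "card F = C * 2 ^ k" "F \<subseteq> {c. val (len c) X = wrd c \<and> 1 / 2 ^ len c \<le> g c}"
        using infinite_arbitrarily_large[OF inf] by blast
      have "\<exists>s. big c s" if "c \<in> F" for c
      proof -
        have "1 / 2 ^ len c \<le> g c" using that F(3) by blast
        moreover have "(1::real) / 2 ^ Suc (len c) < 1 / 2 ^ len c" by (simp add: field_simps)
        ultimately have "1 / 2 ^ Suc (len c) < g c" by linarith
        from order_tendstoD(1)[OF lim[of c] this] show ?thesis
          unfolding big_def q_def eventually_sequentially by blast
      qed
      then obtain s where s: "\<And>c. c \<in> F \<Longrightarrow> big c (s c)" by metis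
      define S where "S = Max (insert 0 ((\<lambda>c. Suc c + len c + s c) ` F))"
      have S: "Suc c + len c + s c \<le> S" if "c \<in> F" for c
        unfolding S_def using F(1) that by (intro Max_ge) auto
      have "big c S" if "c \<in> F" for c
        using s[OF that] inc'[of "s c" S c] S[OF that] unfolding big_def by linarith
      then have "F \<subseteq> {c. c < S \<and> len c \<le> S \<and> val (len c) X = wrd c \<and> big c S}"
        using S F(3) by fastforce
      then have "card F \<le> N S (val S X)" unfolding N_val by (intro card_mono) auto
      then show ?thesis unfolding V_def F(2) by blast
    qed
  qed
qed

lemma MLR_subset_SR_if_bounded:
  assumes "\<And>f. (\<And>n. 0 \<le> f n) \<Longrightarrow> computable_real_fun_in A f \<Longrightarrow> summable f \<Longrightarrow>
     computable_real_in no_oracle (\<Sum>n. f n) \<Longrightarrow>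
     \<exists>g. (\<forall>n. 0 \<le> g n) \<and> left_ce_fun g \<and> summable g \<and> f \<le> g"
  shows "MLR \<subseteq> SR A"
proof (unfold SR_def, intro subsetI CollectI allI impI notI)
  fix X U assume X: "X \<in> MLR" and U: "Schnorr_test_in A U" and XU: "X \<in> (\<Inter>n. U n)"
  obtain f where f: "\<forall>c. 0 \<le> f c" "computable_real_fun_in A f" "f sums 2"
    "\<forall>X n. X \<in> U n \<longrightarrow> (\<exists>c. p1 c = n \<and> val (len c) X = wrd c \<and> f c = 1 / 2 ^ len c)"
    using Schnorr_weights[OF U] .
  have "computable_real_in no_oracle 2" unfolding computable_real_in_def
    by (intro exI[of _ "\<lambda>_. dyadic_code 2 0"] conjI computability) (simp add: real_of_dyadic_code)
  then obtain g where g: "\<And>n. 0 \<le> g n" "left_ce_fun g" "summable g" "f \<le> g"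
    using assms[OF _ f(2)] f(1,3) by (auto simp: sums_iff)
  obtain V where V: "MartinLoef_test V"
    "\<forall>X k. infinite {c. val (len c) X = wrd c \<and> 1 / 2 ^ len c \<le> g c} \<longrightarrow> X \<in> V k"
    using heavy_cylinders_test[OF g(1-3)] .
  let ?H = "{c. val (len c) X = wrd c \<and> 1 / 2 ^ len c \<le> g c}"
  have "n \<in> p1 ` ?H" for n
  proof -
    obtain c where c: "p1 c = n" "val (len c) X = wrd c" "f c = 1 / 2 ^ len c"
      using f(4) XU by blast
    moreover have "f c \<le> g c" using g(4) by (simp add: le_fun_def)
    ultimately show ?thesis by force
  qed
  then have "p1 ` ?H = UNIV" by blast
  then have "infinite ?H" using finite_imageI[of ?H p1] by auto
  then have "X \<in> (\<Inter>k. V k)" using V(2) by blast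
  then show False using X V(1) unfolding MLR_def by blast
qed

section \<open>Dyadic majorants with computable tails\<close>

text \<open>
  Rounds the nonnegative part of a coded rational down to a multiple of \<open>2 ^ - k\<close>, which reduces all later
  computations with reals to natural numbers.
\<close>
definition dyadic_floor :: "nat \<Rightarrow> nat \<Rightarrow> nat" where
  "dyadic_floor c k = (if p1 c mod 2 = 0 then (p1 c div 2 * 2 ^ k) div Suc (p2 c) else 0)"

lemma computable_dyadic_floor [computability]:
  assumes "computable_in A f" "computable_in A g"
  shows "computable_in A (\<lambda>x. dyadic_floor (f x) (g x))"
  unfolding dyadic_floor_def by (intro computability assms)

lemma dyadic_floor_approx:
  assumes "0 \<le> r" "\<bar>r - real_of_rat (rat_of_code c)\<bar> \<le> 1 / 2 ^ k"
  shows "\<bar>r * 2 ^ k - real (dyadic_floor c k)\<bar> \<le> 2"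
proof -
  define q where "q = real_of_rat (rat_of_code c)"
  have "\<bar>r * 2 ^ k - q * 2 ^ k\<bar> = \<bar>r - q\<bar> * 2 ^ k" by (simp add: abs_mult flip: left_diff_distrib)
  also have "\<dots> \<le> 1 / 2 ^ k * 2 ^ k" using assms(2) unfolding q_def by (rule mult_right_mono) simp
  finally have *: "\<bar>r * 2 ^ k - q * 2 ^ k\<bar> \<le> 1" by simp
  show ?thesis
  proof (cases "p1 c mod 2 = 0")
    case True
    define a b where "a = p1 c div 2" and "b = Suc (p2 c)"
    have q: "q * 2 ^ k = real (a * 2 ^ k) / real b"
      using True by (simp add: q_def real_of_code int_decode_eq a_def b_def)
    have "0 \<le> real (a * 2 ^ k) / real b - real ((a * 2 ^ k) div b)"
      "real (a * 2 ^ k) / real b - real ((a * 2 ^ k) div b) \<le> 1"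
      using real_of_int_div2[of "int (a * 2 ^ k)" "int b"] real_of_int_div3[of "int (a * 2 ^ k)" "int b"]
      by (simp_all only: of_int_of_nat_eq flip: zdiv_int)
    moreover have "dyadic_floor c k = (a * 2 ^ k) div b" using True by (simp add: dyadic_floor_def a_def b_def)
    ultimately show ?thesis using * q by linarith
  next
    case False
    then have "q \<le> 0" unfolding q_def real_of_code int_decode_eq by (simp add: divide_nonpos_nonneg)
    then have "q * 2 ^ k \<le> 0" by (simp add: mult_nonpos_nonneg)
    moreover have "0 \<le> r * 2 ^ k" using assms(1) by simp
    ultimately show ?thesis using * False by (simp add: dyadic_floor_def)
  qed
qed

lemma computable_real_fun_dyadic:
  assumes "computable_real_fun_in A f" "\<And>n. 0 \<le> f n"
  obtains F where "computable2 A F" "\<forall>n k. \<bar>f n * 2 ^ k - real (F n k)\<bar> \<le> 2"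
proof -
  obtain q where q: "computable_rat_array_in A q" "\<forall>n k. \<bar>f n - real_of_rat (q n k)\<bar> \<le> 1 / 2 ^ k"
    using assms(1) unfolding computable_real_fun_in_def by blast
  obtain h where h: "computable_in A h" "\<forall>n k. q n k = rat_of_code (h (prod_encode (n, k)))"
    using q(1) unfolding computable_rat_array_in_def by blast
  show ?thesis
  proof (rule that)
    show "computable2 A (\<lambda>n k. dyadic_floor (h (prod_encode (n, k))) k)"
      by (intro computability computable_comp[OF h(1)])
    show "\<forall>n k. \<bar>f n * 2 ^ k - real (dyadic_floor (h (prod_encode (n, k))) k)\<bar> \<le> 2"
      using q(2) h(2) assms(2) by (intro allI dyadic_floor_approx) auto
  qed
qed

lemma computable_real_dyadic:
  assumes "computable_real_in A r" "0 \<le> r"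
  obtains F where "computable_in A F" "\<forall>k. \<bar>r * 2 ^ k - real (F k)\<bar> \<le> 2"
proof -
  obtain h where h: "computable_in A h" "\<forall>k. \<bar>r - real_of_rat (rat_of_code (h k))\<bar> \<le> 1 / 2 ^ k"
    using assms(1) unfolding computable_real_in_def by blast
  show ?thesis
  proof (rule that)
    show "computable_in A (\<lambda>k. dyadic_floor (h k) k)"
      by (intro computability computable_comp[OF h(1)])
    show "\<forall>k. \<bar>r * 2 ^ k - real (dyadic_floor (h k) k)\<bar> \<le> 2"
      using h(2) assms(2) by (intro allI dyadic_floor_approx) auto
  qed
qed

lemma tail_antimono:
  fixes x :: "nat \<Rightarrow> real"
  assumes "summable x" "\<And>i. 0 \<le> x i" "M \<le> N"
  shows "(\<Sum>i. x (i + N)) \<le> (\<Sum>i. x (i + M))"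
proof -
  have "sum x {..<M} \<le> sum x {..<N}" using assms(2,3) by (intro sum_mono2) auto
  then show ?thesis
    using suminf_split_initial_segment[OF assms(1), of M] suminf_split_initial_segment[OF assms(1), of N] by linarith
qed

text \<open>
  Rounding \<open>f i + O(2 ^ - i)\<close> up to a power of two at most doubles it, so the majorant \<open>2 ^ - k i\<close> is bounded by
  \<open>2 * f i + 8 * 2 ^ - i\<close>. Its tails are controlled by those of \<open>f\<close>, which can be estimated in \<open>A\<close> because
  the sum of \<open>f\<close> is \<open>A\<close>-computable. Exponents are truncated at \<open>0\<close>, which makes the
  bound on \<open>f i\<close> fail only for the finitely many \<open>i\<close> with \<open>f i\<close> large.
\<close>
lemma ex_dyadic_majorant:
  assumes nonneg: "\<And>n. 0 \<le> f n" and f: "computable_real_fun_in A f" "summable f"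
    and S: "computable_real_in A (\<Sum>n. f n)"
  obtains k m where "computable_in A k" "computable_in A m" "mono m" "\<forall>n. n \<le> m n"
    "\<forall>\<^sub>F i in sequentially. f i \<le> 1 / 2 ^ k i" "summable (\<lambda>i. 1 / 2 ^ k i :: real)"
    "\<forall>n. (\<Sum>i. 1 / 2 ^ k (i + m n)) \<le> (1 / 2 ^ Suc n :: real)"
proof -
  obtain F where F: "computable2 A F" "\<forall>n k. \<bar>f n * 2 ^ k - real (F n k)\<bar> \<le> 2"
    using computable_real_fun_dyadic[OF f(1) nonneg] .
  obtain G where G: "computable_in A G" "\<forall>k. \<bar>(\<Sum>n. f n) * 2 ^ k - real (G k)\<bar> \<le> 2"
    using computable_real_dyadic[OF S suminf_nonneg[OF f(2) nonneg]] .
  \<comment> \<open>\<open>2 ^ l i\<close> is the least power of two above an upper estimate of \<open>f i * 2 ^ i\<close>\<close>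
  define l where "l i = (LEAST l. F i i + 2 \<le> 2 ^ l)" for i
  define k where "k i = i - l i" for i
  define x where "x i = (1 / 2 ^ k i :: real)" for i
  have ex_l: "\<exists>l. F i i + 2 \<le> 2 ^ l" for i
    by (rule exI[of _ "F i i + 2"]) (simp only: less_exp less_imp_le)
  have l: "F i i + 2 \<le> 2 ^ l i" for i unfolding l_def by (rule LeastI_ex[OF ex_l])
  have l': "2 ^ l i \<le> 2 * (F i i + 2)" for i
  proof (cases "l i")
    case (Suc r)
    then have "\<not> F i i + 2 \<le> 2 ^ r" using not_less_Least[of r "\<lambda>l. F i i + 2 \<le> 2 ^ l"] by (simp add: l_def)
    then show ?thesis using Suc by simp
  qed simp
  have f_le: "f i \<le> 2 ^ l i / 2 ^ i" for i
  proof -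
    have "f i * 2 ^ i \<le> real (F i i + 2)" using F(2)[rule_format, of i i] by (simp; linarith?)
    also have "\<dots> \<le> real (2 ^ l i)" using l[of i] by (simp only: of_nat_le_iff)
    finally show ?thesis by (simp add: field_simps)
  qed
  have le_f: "2 ^ l i / 2 ^ i \<le> 2 * f i + 8 / 2 ^ i" for i
  proof -
    have "real (2 ^ l i) \<le> real (2 * (F i i + 2))" using l'[of i] by (simp only: of_nat_le_iff)
    also have "\<dots> \<le> 2 * (f i * 2 ^ i + 4)" using F(2)[rule_format, of i i] by (simp; linarith?)
    finally show ?thesis by (simp add: field_simps)
  qed
  have x_le: "x i \<le> 2 ^ l i / 2 ^ i" for i
  proof (cases "l i \<le> i")
    case True
    then have "(2::real) ^ i = 2 ^ l i * 2 ^ k i" by (simp add: k_def flip: power_add)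
    then show ?thesis by (simp add: x_def)
  next
    case False
    then have "(2::real) ^ i \<le> 2 ^ l i" by (intro power_increasing) auto
    then show ?thesis using False by (simp add: x_def k_def)
  qed
  have x_le': "x i \<le> 2 * f i + 8 * (1 / 2) ^ i" for i
    using x_le[of i] le_f[of i] by (simp add: power_one_over)
  have sum_maj: "summable (\<lambda>i. 2 * f i + 8 * (1 / 2) ^ i :: real)"
    using f(2) by (intro summable_add summable_mult summable_geometric) auto
  have sum_x: "summable x"
    by (rule summable_comparison_test_ev[OF _ sum_maj]) (use x_le' in \<open>simp add: x_def\<close>)
  have ev: "\<forall>\<^sub>F i in sequentially. f i \<le> x i"
  proof -
    have "(\<lambda>i. 2 * f i + 8 * (1 / 2) ^ i :: real) \<longlonglongrightarrow> 0" using sum_maj by (rule summable_LIMSEQ_zero)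
    then have "\<forall>\<^sub>F i in sequentially. 2 * f i + 8 * (1 / 2) ^ i < (1::real)" by (rule order_tendstoD) simp
    then show ?thesis
    proof eventually_elim
      case (elim i)
      moreover have "8 * (1 / 2) ^ i = (8 / 2 ^ i :: real)" by (simp add: power_one_over)
      ultimately have "(2::real) ^ l i / 2 ^ i < 1" using le_f[of i] by linarith
      then have "l i \<le> i" by simp
      then have "(2::real) ^ i = 2 ^ l i * 2 ^ k i" by (simp add: k_def flip: power_add)
      then show ?case using f_le[of i] by (simp add: x_def)
    qed
  qed
  define tl where "tl M = (\<Sum>i. f (i + M))" for M
  have tl: "tl M = (\<Sum>n. f n) - (\<Sum>i<M. f i)" for M
    unfolding tl_def using suminf_split_initial_segment[OF f(2), of M] by linarith
  have tl_lim: "tl \<longlonglongrightarrow> 0" unfolding tl using summable_LIMSEQ[OF f(2)] by (auto intro!: tendsto_eq_intros)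
  \<comment> \<open>implies that the tail of \<open>f\<close> from \<open>M\<close> on is small: with precision \<open>p = n + M + 6\<close> the rounding errors, at most \<open>2 + 2 * M\<close> units of \<open>2 ^ - p\<close>, are absorbed by the slack\<close>
  define Q where "Q n M \<longleftrightarrow> n + 6 \<le> M \<and> G (n + M + 6) \<le> (\<Sum>i<M. F i (n + M + 6)) + 2 ^ (M + 2)" for n M
  have approx: "\<bar>tl M * 2 ^ p - (real (G p) - real (\<Sum>i<M. F i p))\<bar> \<le> 2 + 2 * real M" for M p
  proof -
    have "\<bar>(\<Sum>i<M. f i * 2 ^ p - real (F i p))\<bar> \<le> (\<Sum>i<M. \<bar>f i * 2 ^ p - real (F i p)\<bar>)" by (rule sum_abs)
    also have "\<dots> \<le> (\<Sum>i<M. 2)" by (intro sum_mono F(2)[rule_format])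
    finally have "\<bar>(\<Sum>i<M. f i * 2 ^ p - real (F i p))\<bar> \<le> 2 * real M" by simp
    moreover have "tl M * 2 ^ p - (real (G p) - real (\<Sum>i<M. F i p)) =
        ((\<Sum>n. f n) * 2 ^ p - real (G p)) - (\<Sum>i<M. f i * 2 ^ p - real (F i p))"
      by (simp add: tl left_diff_distrib sum_subtractf sum_distrib_right)
    ultimately show ?thesis using G(2)[rule_format, of p] by linarith
  qed
  have small: "2 + 2 * real M \<le> 2 ^ (M + 1)" for M
  proof -
    have "Suc M \<le> 2 ^ M" by (simp add: Suc_leI)
    then have "real (2 * Suc M) \<le> real (2 * 2 ^ M)" by (simp only: of_nat_le_iff mult_le_mono2)
    then show ?thesis by simp
  qed
  have Q_sound: "tl M \<le> 1 / 2 ^ (n + 3)" if "Q n M" for n M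
  proof -
    let ?p = "n + M + 6"
    have "real (G ?p) \<le> real ((\<Sum>i<M. F i ?p) + 2 ^ (M + 2))" using that unfolding Q_def of_nat_le_iff by blast
    then have "real (G ?p) - real (\<Sum>i<M. F i ?p) \<le> 2 ^ (M + 2)" by simp
    then have "tl M * 2 ^ ?p \<le> 2 ^ (M + 2) + 2 ^ (M + 1)" using approx[of M ?p] small[of M] by linarith
    also have "\<dots> \<le> (2::real) ^ (M + 3)" by (simp add: power_add)
    finally show ?thesis by (simp add: power_add field_simps)
  qed
  have Q_ex: "\<exists>M. Q n M" for n
  proof -
    have "\<forall>\<^sub>F M in sequentially. tl M < 1 / 2 ^ (n + 5)" by (rule order_tendstoD[OF tl_lim]) simp
    then obtain M0 where M0: "\<And>M. M \<ge> M0 \<Longrightarrow> tl M < 1 / 2 ^ (n + 5)" unfolding eventually_sequentially by blast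
    define M where "M = M0 + n + 6"
    let ?p = "n + M + 6"
    have "tl M * 2 ^ ?p \<le> 1 / 2 ^ (n + 5) * 2 ^ ?p"
      by (rule mult_right_mono) (use M0[of M] in \<open>auto simp: M_def\<close>)
    also have "\<dots> = 2 ^ (M + 1)" by (simp add: power_add)
    finally have "real (G ?p) - real (\<Sum>i<M. F i ?p) \<le> 2 ^ (M + 1) + 2 ^ (M + 1)"
      using approx[of M ?p] small[of M] by linarith
    then have "real (G ?p) \<le> real ((\<Sum>i<M. F i ?p) + 2 ^ (M + 2))" by (simp add: power_add)
    then have "Q n M" unfolding Q_def of_nat_le_iff by (simp add: M_def)
    then show ?thesis ..
  qed
  define m0 where "m0 n = (LEAST M. Q n M)" for n
  have m0: "Q n (m0 n)" for n unfolding m0_def by (rule LeastI_ex[OF Q_ex])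
  \<comment> \<open>summation makes the bounds monotone\<close>
  define m where "m n = (\<Sum>j<Suc n. m0 j)" for n
  have m_ge: "m0 n \<le> m n" for n unfolding m_def by simp
  have tail_x: "(\<Sum>i. x (i + m n)) \<le> 1 / 2 ^ Suc n" for n
  proof -
    let ?M = "m0 n"
    have geo: "summable (\<lambda>i. 8 * (1 / 2) ^ (i + ?M) :: real)"
      by (intro summable_mult summable_ignore_initial_segment summable_geometric) simp
    have sf: "summable (\<lambda>i. f (i + ?M))" using f(2) by (rule summable_ignore_initial_segment)
    have "(\<Sum>i. x (i + m n)) \<le> (\<Sum>i. x (i + ?M))"
      by (rule tail_antimono[OF sum_x _ m_ge]) (simp add: x_def)
    also have "\<dots> \<le> (\<Sum>i. 2 * f (i + ?M) + 8 * (1 / 2) ^ (i + ?M))"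
      by (rule suminf_le[OF x_le' summable_ignore_initial_segment[OF sum_x] summable_add[OF summable_mult[OF sf] geo]])
    also have "\<dots> = 2 * tl ?M + (\<Sum>i. 8 * (1 / 2) ^ (i + ?M))"
      unfolding tl_def suminf_add[OF summable_mult[OF sf] geo, symmetric] suminf_mult[OF sf] ..
    also have "(\<Sum>i. 8 * (1 / 2) ^ (i + ?M)) = 8 * (1 / 2) ^ ?M * (\<Sum>i. (1 / 2) ^ i :: real)"
      by (subst suminf_mult[symmetric]) (simp_all add: power_add mult_ac summable_geometric)
    also have "(\<Sum>i. (1 / 2) ^ i :: real) = 2" by (subst suminf_geometric) simp_all
    also have "8 * (1 / 2) ^ ?M * 2 = (16 / 2 ^ ?M :: real)" by (simp add: power_one_over)
    also have "\<dots> \<le> 16 / 2 ^ (n + 6)"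
      using m0[of n] unfolding Q_def by (intro divide_left_mono power_increasing) auto
    also have "2 * tl ?M + 16 / 2 ^ (n + 6) \<le> 1 / 2 ^ Suc n"
      using Q_sound[OF m0[of n]] by (simp add: power_add field_simps)
    finally show ?thesis by simp
  qed
  show ?thesis
  proof (rule that)
    show "computable_in A k" unfolding k_def l_def
      using ex_l by (intro computability computable_Least computable_comp2[OF F(1)])
    show "computable_in A m" unfolding m_def m0_def
      using Q_ex unfolding Q_def by (intro computability computable_Least computable_comp2[OF F(1)] computable_comp[OF G(1)])
    show "mono m" unfolding m_def by (intro monoI sum_mono2) auto
    show "\<forall>n. n \<le> m n" using m0 m_ge unfolding Q_def by (meson add_leD1 le_trans)
    show "\<forall>\<^sub>F i in sequentially. f i \<le> 1 / 2 ^ k i" using ev unfolding x_def .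
    show "summable (\<lambda>i. 1 / 2 ^ k i :: real)" using sum_x unfolding x_def .
    show "\<forall>n. (\<Sum>i. 1 / 2 ^ k (i + m n)) \<le> (1 / 2 ^ Suc n :: real)" using tail_x unfolding x_def by blast
  qed
qed

section \<open>Padding to a Schnorr test\<close>

text \<open>
  \<open>U n = (\<Union>e. E n e)\<close> is enlarged by the lexicographically initial segment for which the union has
  measure exactly \<open>2 ^ - n\<close>. An initial segment may be added whenever the measure of its union with
  \<open>U n\<close> stays strictly below \<open>2 ^ - n\<close>; this is a semidecidable condition, since \<open>E n e\<close> approximates \<open>U n\<close> up to
  \<open>2 ^ - e\<close>. As the segments grow in steps of \<open>2 ^ - t\<close>, no gap remains in the limit. Since
  the measure of \<open>U n\<close> is at most \<open>2 ^ - (n + 1)\<close>, the segment added to \<open>U n\<close> has at least this measure and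
  therefore contains the one added to \<open>U (n + 1)\<close>.
\<close>
lemma Schnorr_padding:
  fixes D :: "nat \<Rightarrow> nat \<Rightarrow> nat \<Rightarrow> bool" and L :: "nat \<Rightarrow> nat"
  defines "E \<equiv> \<lambda>n e. {X. D n e (val (L e) X)}"
  assumes D: "decidable3 A D" and L: "computable_in A L"
    and decr: "\<And>n e. E (Suc n) e \<subseteq> E n e"
    and tail: "\<And>n e. \<mu> ((\<Union>e. E n e) - E n e) \<le> 1 / 2 ^ e"
    and small: "\<And>n. \<mu> (\<Union>e. E n e) \<le> 1 / 2 ^ Suc n"
  obtains V where "Schnorr_test_in A V" "\<forall>n e. E n e \<subseteq> V n"
proof -
  define U where "U n = (\<Union>e. E n e)" for n
  define I where "I t v = {X. val t X < v}" for t v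
  have E_sets: "E n e \<in> sets cantor_measure" for n e unfolding E_def by (rule sets_val)
  have U_sets: "U n \<in> sets cantor_measure" for n
    unfolding U_def using E_sets by (intro sets.countable_UN) blast
  have I_sets: "I t v \<in> sets cantor_measure" for t v unfolding I_def by (rule sets_val)
  have I_double: "I (Suc t) (2 * v) = I t v" for t v unfolding I_def by auto
  have I_mono: "u \<le> v \<Longrightarrow> I t u \<subseteq> I t v" for t u v unfolding I_def by auto
  have I_step: "\<mu> (B \<union> I t (Suc v)) \<le> \<mu> (B \<union> I t v) + 1 / 2 ^ t"
    if B: "B \<in> sets cantor_measure" and v: "v < 2 ^ t" for B t v
  proof -
    have "B \<union> I t (Suc v) = (B \<union> I t v) \<union> {X. val t X = v}" by (auto simp: I_def)
    then have "\<mu> (B \<union> I t (Suc v)) \<le> \<mu> (B \<union> I t v) + \<mu> {X. val t X = v}"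
      using B I_sets sets_val_eq[OF v] by (simp add: measure_Un_le)
    then show ?thesis using measure_val_eq[OF v] by simp
  qed
  \<comment> \<open>the integer form of \<open>\<mu> (E n e \<union> I t v) + 2 ^ - e < 2 ^ - n\<close>, counting strings of length \<open>t + L e\<close>, whose first \<open>t\<close> bits determine \<open>I t v\<close> and whose first \<open>L e\<close> bits determine \<open>E n e\<close>\<close>
  define cond where "cond n e t v \<longleftrightarrow>
      (\<Sum>w<2 ^ (t + L e). of_bool (w div 2 ^ L e < v \<or> D n e (w div 2 ^ t))) * 2 ^ (e + n) + 2 ^ (t + L e + n)
        < (2 ^ (t + L e + e) :: nat)" for n e t v
  have cond: "cond n e t v \<longleftrightarrow> \<mu> (E n e \<union> I t v) + 1 / 2 ^ e < 1 / 2 ^ n" for n e t v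
  proof -
    define c :: nat where "c = (\<Sum>w<2 ^ (t + L e). of_bool (w div 2 ^ L e < v \<or> D n e (w div 2 ^ t)))"
    have "E n e \<union> I t v = {X. (\<lambda>w. w div 2 ^ L e < v \<or> D n e (w div 2 ^ t)) (val (t + L e) X)}"
      unfolding E_def I_def using val_div[of t "L e"] val_div[of "L e" t] by (auto simp: add.commute)
    then have \<mu>: "\<mu> (E n e \<union> I t v) = real c / 2 ^ (t + L e)"
      unfolding c_def by (simp only: measure_val[of "\<lambda>w. w div 2 ^ L e < v \<or> D n e (w div 2 ^ t)"])
    have "cond n e t v \<longleftrightarrow> real (c * 2 ^ (e + n) + 2 ^ (t + L e + n)) < real (2 ^ (t + L e + e))"
      unfolding cond_def c_def[symmetric] of_nat_less_iff ..
    also have "\<dots> \<longleftrightarrow> real c / 2 ^ (t + L e) + 1 / 2 ^ e < 1 / 2 ^ n"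
      by (simp add: field_simps power_add)
    finally show ?thesis unfolding \<mu> .
  qed
  define good where "good n t v \<longleftrightarrow> \<mu> (U n \<union> I t v) < 1 / 2 ^ n" for n t v
  have good_iff: "good n t v \<longleftrightarrow> (\<exists>e. cond n e t v)" for n t v
  proof
    assume g: "good n t v"
    then have "0 < 1 / 2 ^ n - \<mu> (U n \<union> I t v)" unfolding good_def by simp
    then have "\<exists>e. (1 / 2) ^ e < 1 / 2 ^ n - \<mu> (U n \<union> I t v)" by (rule real_arch_pow_inv) simp
    then obtain e where e: "(1 / 2) ^ e < 1 / 2 ^ n - \<mu> (U n \<union> I t v)" ..
    have "\<mu> (E n e \<union> I t v) \<le> \<mu> (U n \<union> I t v)"
      by (rule cantor.finite_measure_mono) (use U_sets I_sets in \<open>auto simp: U_def\<close>)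
    then show "\<exists>e. cond n e t v" unfolding cond using e by (auto simp: power_one_over intro!: exI[of _ e])
  next
    assume "\<exists>e. cond n e t v"
    then obtain e where e: "\<mu> (E n e \<union> I t v) + 1 / 2 ^ e < 1 / 2 ^ n" unfolding cond ..
    have "U n \<union> I t v = (E n e \<union> I t v) \<union> (U n - E n e)" by (auto simp: U_def)
    then have "\<mu> (U n \<union> I t v) \<le> \<mu> (E n e \<union> I t v) + \<mu> (U n - E n e)"
      using E_sets I_sets U_sets by (simp add: measure_Un_le)
    then show "good n t v" unfolding good_def using e tail[of n e] unfolding U_def by linarith
  qed
  have good_0: "good n t 0" for n t
  proof -
    have "\<mu> (U n) < 1 / 2 ^ n" by (rule le_less_trans[OF small[of n, folded U_def]]) (simp add: field_simps)
    then show ?thesis by (simp add: good_def I_def)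
  qed
  have good_less: "v < 2 ^ t" if "good n t v" for n t v
  proof (rule ccontr)
    assume "\<not> v < 2 ^ t"
    then have "I t v = UNIV" by (auto simp: I_def intro: less_le_trans[OF val_less])
    then have "U n \<union> I t v = space cantor_measure" by simp
    then have "\<mu> (U n \<union> I t v) = 1" by (simp only: cantor.prob_space)
    moreover have "(1::real) / 2 ^ n \<le> 1" by simp
    ultimately show False using that unfolding good_def by linarith
  qed
  define R where "R n z w \<longleftrightarrow> D n (p1 z) (w div 2 ^ len z) \<or> cond n (p1 z) (len z) (wrd z) \<and> w div 2 ^ L (p1 z) < wrd z" for n z w
  define V where "V n = {X. \<exists>z. R n z (val (len z + L (p1 z)) X)}" for n
  have V: "V n = U n \<union> (\<Union>t. \<Union>v\<in>{v. good n t v}. I t v)" for n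
  proof (intro set_eqI iffI)
    fix X assume "X \<in> V n"
    then obtain z where "R n z (val (len z + L (p1 z)) X)" unfolding V_def by blast
    then have "D n (p1 z) (val (L (p1 z)) X) \<or> cond n (p1 z) (len z) (wrd z) \<and> val (len z) X < wrd z"
      unfolding R_def using val_div[of "len z" "L (p1 z)" X] val_div[of "L (p1 z)" "len z" X] by (simp add: add.commute)
    then show "X \<in> U n \<union> (\<Union>t. \<Union>v\<in>{v. good n t v}. I t v)"
      unfolding U_def E_def I_def good_iff by blast
  next
    fix X assume "X \<in> U n \<union> (\<Union>t. \<Union>v\<in>{v. good n t v}. I t v)"
    then consider e where "D n e (val (L e) X)" | e t v where "cond n e t v" "val t X < v"
      unfolding U_def E_def I_def good_iff by blast
    then show "X \<in> V n"
    proof cases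
      case 1
      then have "R n (prod_encode (e, prod_encode (0, 0))) (val (0 + L e) X)" unfolding R_def by simp
      then show ?thesis unfolding V_def by (intro CollectI exI[of _ "prod_encode (e, prod_encode (0, 0))"]) simp
    next
      case 2
      then have "R n (prod_encode (e, prod_encode (t, v))) (val (t + L e) X)" unfolding R_def by (simp add: val_div)
      then show ?thesis unfolding V_def by (intro CollectI exI[of _ "prod_encode (e, prod_encode (t, v))"]) simp
    qed
  qed
  have V_ce: "uniformly_ce_open_in A V"
    unfolding V_def R_def cond_def
    by (intro ce_openI computability decidable_comp3[OF D] computable_comp[OF L])
  have V_sets: "V n \<in> sets cantor_measure" for n unfolding V_def by (rule sets_ex_val)
  have V_measure: "\<mu> (V n) = 1 / 2 ^ n" for n
  proof -
    \<comment> \<open>the largest admissible segment at resolution \<open>2 ^ - t\<close>\<close>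
    define r where "r t = Max {v. good n t v}" for t
    have fin: "finite {v. good n t v}" for t by (rule finite_subset[of _ "{..<2 ^ t}"]) (auto dest: good_less)
    have r: "good n t (r t)" for t using Max_in[OF fin[of t]] good_0[of n t] unfolding r_def by blast
    have r_max: "v \<le> r t" if "good n t v" for t v unfolding r_def using fin[of t] that by (intro Max_ge) auto
    have inc: "incseq (\<lambda>t. U n \<union> I t (r t))"
    proof (rule incseq_SucI)
      fix t
      have "good n (Suc t) (2 * r t)" using r[of t] unfolding good_def I_double .
      then have "I t (r t) \<subseteq> I (Suc t) (r (Suc t))" using I_mono[OF r_max] I_double by metis
      then show "U n \<union> I t (r t) \<subseteq> U n \<union> I (Suc t) (r (Suc t))" by blast
    qed
    have V_UN: "V n = (\<Union>t. U n \<union> I t (r t))"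
    proof -
      have "(\<Union>v\<in>{v. good n t v}. I t v) = I t (r t)" for t
      proof (intro equalityI UN_least)
        show "I t v \<subseteq> I t (r t)" if "v \<in> {v. good n t v}" for v
          using that by (intro I_mono r_max) simp
        show "I t (r t) \<subseteq> (\<Union>v\<in>{v. good n t v}. I t v)" using r[of t] by (intro UN_upper) simp
      qed
      then show ?thesis unfolding V by auto
    qed
    have "(\<lambda>t. \<mu> (U n \<union> I t (r t))) \<longlonglongrightarrow> \<mu> (V n)"
      unfolding V_UN using inc U_sets I_sets by (intro cantor.finite_Lim_measure_incseq) auto
    then have upper: "\<mu> (V n) \<le> 1 / 2 ^ n"
      by (rule LIMSEQ_le_const2) (use r in \<open>auto simp: good_def intro!: less_imp_le\<close>)
    have "1 / 2 ^ n - \<mu> (V n) \<le> (1 / 2) ^ t" for t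
    proof -
      have "\<not> good n t (Suc (r t))" using r_max[of t "Suc (r t)"] by auto
      then have "1 / 2 ^ n \<le> \<mu> (U n \<union> I t (Suc (r t)))" unfolding good_def by simp
      also have "\<dots> \<le> \<mu> (U n \<union> I t (r t)) + 1 / 2 ^ t" by (rule I_step[OF U_sets good_less[OF r]])
      also have "\<mu> (U n \<union> I t (r t)) \<le> \<mu> (V n)"
        by (rule cantor.finite_measure_mono[OF _ V_sets]) (auto simp: V_UN)
      finally show ?thesis by (simp add: power_one_over)
    qed
    then have "1 / 2 ^ n - \<mu> (V n) \<le> 0"
      by (intro LIMSEQ_le_const[OF LIMSEQ_realpow_zero[of "1 / 2"]]) auto
    then show ?thesis using upper by linarith
  qed
  have "decseq V"
  proof (rule decseq_SucI)
    fix n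
    have "U (Suc n) \<subseteq> U n" unfolding U_def using decr by blast
    moreover have "good n t v" if "good (Suc n) t v" for t v
    proof -
      have "\<mu> (I t v) \<le> \<mu> (U (Suc n) \<union> I t v)"
        by (rule cantor.finite_measure_mono) (use U_sets I_sets in auto)
      moreover have "\<mu> (U n \<union> I t v) \<le> \<mu> (U n) + \<mu> (I t v)"
        by (rule measure_Un_le[OF U_sets I_sets])
      moreover have "(1::real) / 2 ^ n = 1 / 2 ^ Suc n + 1 / 2 ^ Suc n" by simp
      ultimately show ?thesis using that small[of n] unfolding good_def U_def by linarith
    qed
    ultimately show "V (Suc n) \<subseteq> V n" unfolding V by blast
  qed
  then have "Schnorr_test_in A V" unfolding Schnorr_test_in_def using V_ce V_measure by blast
  moreover have "\<forall>n e. E n e \<subseteq> V n" unfolding V U_def by blast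
  ultimately show ?thesis by (rule that)
qed

section \<open>Blocks of zeros\<close>

text \<open>
  The coordinates reserved for \<open>c\<close>; when \<open>c\<close> codes a pair \<open>(i, k)\<close> there are \<open>k\<close> of them.
\<close>
definition block :: "nat \<Rightarrow> nat set" where
  "block c = (\<lambda>j. prod_encode (c, j)) ` {..<p2 c}"

definition zero_block :: "nat \<Rightarrow> cantor set" where
  "zero_block c = {X. \<forall>i\<in>block c. \<not> X i}"

lemma finite_block [simp]: "finite (block c)"
  by (simp add: block_def)

lemma card_block: "card (block c) = p2 c"
  unfolding block_def by (subst card_image) (auto simp: inj_on_def)

lemma sets_zero_block: "zero_block c \<in> sets cantor_measure"
  unfolding zero_block_def by (rule sets_zeros) simp

lemma measure_zero_block: "\<mu> (zero_block c) = 1 / 2 ^ p2 c"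
  unfolding zero_block_def by (simp add: measure_zeros card_block)

lemma measure_avoid_zero_blocks:
  assumes "finite F"
  shows "\<mu> (UNIV - (\<Union>c\<in>F. zero_block c)) = (\<Prod>c\<in>F. 1 - 1 / 2 ^ p2 c)"
proof -
  have "UNIV - (\<Union>c\<in>F. zero_block c) = {X. (\<forall>i\<in>{}. \<not> X i) \<and> (\<forall>c\<in>F. \<exists>i\<in>block c. X i)}"
    by (auto simp: zero_block_def)
  moreover have "disjoint_family_on block F" by (auto simp: disjoint_family_on_def block_def)
  ultimately show ?thesis
    using measure_avoid_blocks[of F "{}" block] assms by (simp add: card_block)
qed

text \<open>
  The unions of the blocks from \<open>m n\<close> on have measures that can be approximated in \<open>A\<close>: by the union bound,
  the blocks from \<open>m e\<close> on contribute at most \<open>2 ^ - (e + 1)\<close>, and finitely many blocks form a clopen set.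
\<close>
lemma Schnorr_test_zero_blocks:
  assumes k: "computable_in A k" and m: "computable_in A m" "mono m" "\<forall>n. n \<le> m n"
    and x: "summable (\<lambda>i. 1 / 2 ^ k i :: real)" "\<forall>n. (\<Sum>i. 1 / 2 ^ k (i + m n)) \<le> (1 / 2 ^ Suc n :: real)"
  obtains V where "Schnorr_test_in A V" "\<forall>n i. m n \<le> i \<longrightarrow> zero_block (prod_encode (i, k i)) \<subseteq> V n"
proof -
  \<comment> \<open>a prefix length beyond all coordinates of the blocks with index below \<open>m e\<close>\<close>
  define L where "L e = Suc (\<Sum>i<m e. \<Sum>j<k i. prod_encode (prod_encode (i, k i), j))" for e
  define D where "D n e w \<longleftrightarrow> (\<exists>i<m e. m n \<le> i \<and>
      (\<forall>j<k i. w div 2 ^ (L e - Suc (prod_encode (prod_encode (i, k i), j))) mod 2 = 0))" for n e w :: nat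
  let ?B = "\<lambda>i. zero_block (prod_encode (i, k i))"
  have E: "{X. D n e (val (L e) X)} = (\<Union>i\<in>{m n..<m e}. ?B i)" for n e
  proof -
    have "(val (L e) X div 2 ^ (L e - Suc (prod_encode (prod_encode (i, k i), j))) mod 2 = 0)
        \<longleftrightarrow> \<not> X (prod_encode (prod_encode (i, k i), j))" if "i < m e" "j < k i" for X i j
    proof -
      have "prod_encode (prod_encode (i, k i), j) \<le> (\<Sum>j<k i. prod_encode (prod_encode (i, k i), j))"
        using that by (intro member_le_sum) auto
      also have "\<dots> \<le> (\<Sum>i<m e. \<Sum>j<k i. prod_encode (prod_encode (i, k i), j))"
        using that by (intro member_le_sum[of i _ "\<lambda>i. \<Sum>j<k i. prod_encode (prod_encode (i, k i), j)"]) auto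
      finally have "prod_encode (prod_encode (i, k i), j) < L e" unfolding L_def by simp
      from val_digit[OF this] show ?thesis by simp
    qed
    then show ?thesis by (auto simp: D_def zero_block_def block_def Bex_def)
  qed
  have tail: "\<mu> (\<Union>i. ?B (i + m n)) \<le> 1 / 2 ^ Suc n" for n
  proof -
    have "\<mu> (\<Union>i. ?B (i + m n)) \<le> (\<Sum>i. \<mu> (?B (i + m n)))"
      using sets_zero_block summable_ignore_initial_segment[OF x(1), of "m n"]
      by (intro cantor.finite_measure_subadditive_countably) (auto simp: measure_zero_block)
    then show ?thesis using x(2)[rule_format, of n] by (simp add: measure_zero_block)
  qed
  have tail_sets: "(\<Union>i. ?B (i + m n)) \<in> sets cantor_measure" for n
    using sets_zero_block by (intro sets.countable_UN) blast
  have in_tail: "?B i \<subseteq> (\<Union>i. ?B (i + m n))" if "m n \<le> i" for i n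
    using that by (intro UN_upper[of "i - m n" _ "\<lambda>i. ?B (i + m n)", THEN subset_trans[rotated]]) auto
  show ?thesis
  proof (rule Schnorr_padding[of A D L])
    show "decidable3 A D" unfolding D_def L_def
      by (intro computability computable_comp[OF k] computable_comp[OF m(1)])
    show "computable_in A L" unfolding L_def
      by (intro computability computable_comp[OF k] computable_comp[OF m(1)])
    show "{X. D (Suc n) e (val (L e) X)} \<subseteq> {X. D n e (val (L e) X)}" for n e
      unfolding E using monoD[OF m(2), of n "Suc n"] by (intro UN_mono) auto
    show "\<mu> (\<Union>e. {X. D n e (val (L e) X)}) \<le> 1 / 2 ^ Suc n" for n
    proof -
      have "(\<Union>e. {X. D n e (val (L e) X)}) \<subseteq> (\<Union>i. ?B (i + m n))"
        unfolding E by (intro UN_least in_tail) simp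
      from cantor.finite_measure_mono[OF this tail_sets] tail[of n] show ?thesis by linarith
    qed
    show "\<mu> ((\<Union>e. {X. D n e (val (L e) X)}) - {X. D n e (val (L e) X)}) \<le> 1 / 2 ^ e" for n e
    proof -
      have "(\<Union>e. {X. D n e (val (L e) X)}) - {X. D n e (val (L e) X)} \<subseteq> (\<Union>i. ?B (i + m e))"
      proof
        fix X assume "X \<in> (\<Union>e. {X. D n e (val (L e) X)}) - {X. D n e (val (L e) X)}"
        then obtain i where "X \<in> ?B i" "m e \<le> i" unfolding E by (auto simp: not_less)
        then show "X \<in> (\<Union>i. ?B (i + m e))" using in_tail by blast
      qed
      moreover have "(1::real) / 2 ^ Suc e \<le> 1 / 2 ^ e" by (simp add: field_simps)
      ultimately show ?thesis using cantor.finite_measure_mono[OF _ tail_sets] tail[of e] by (meson order_trans)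
    qed
    fix V assume V: "Schnorr_test_in A V" "\<forall>n e. {X. D n e (val (L e) X)} \<subseteq> V n"
    have "?B i \<subseteq> V n" if "m n \<le> i" for n i
    proof -
      \<comment> \<open>every block is reached eventually because \<open>m\<close> is unbounded\<close>
      have "i < m (Suc i)" using m(3) by (metis Suc_le_eq)
      then have "?B i \<subseteq> {X. D n (Suc i) (val (L (Suc i)) X)}" unfolding E using that by auto
      then show ?thesis using V(2) by blast
    qed
    then show thesis using that V(1) by blast
  qed
qed

definition ce_open :: "cantor set \<Rightarrow> bool" where
  "ce_open G \<longleftrightarrow> uniformly_ce_open_in no_oracle (\<lambda>_. G)"

lemma ce_open_stages:
  assumes "ce_open G"
  obtains P where "open_stages no_oracle (\<lambda>_. G) P"
  using ce_openE assms unfolding ce_open_def .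

lemma ce_openI1:
  assumes "decidable2 no_oracle R" "computable_in no_oracle l"
  shows "ce_open {X. \<exists>z. R z (val (l z) X)}"
  unfolding ce_open_def by (rule ce_openI) (intro decidable_comp2[OF assms(1)] computable_comp[OF assms(2)] computability)+

lemma ce_open_sets:
  assumes "ce_open G" shows "G \<in> sets cantor_measure"
proof -
  obtain P where "open_stages no_oracle (\<lambda>_. G) P" using ce_open_stages[OF assms] .
  from open_stagesD(3)[OF this] show ?thesis using sets_ex_val[of "P 0" "\<lambda>z. z"] by simp
qed

text \<open>
  \<open>R c t\<close> says that the part of \<open>zero_block c\<close> outside \<open>G\<close> is seen at stage \<open>t\<close> to have measure at most
  \<open>2 ^ - (d + c)\<close>. Removing all these parts from the complement of \<open>G\<close>, of measure \<open>h\<close>, leaves at least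
  \<open>h / 2\<close>; what is left avoids all blocks in question, so independence and \<open>1 - x \<le> exp (- x)\<close> bound the sum.
\<close>
lemma few_blocks_nearly_covered:
  assumes G: "ce_open G" "\<mu> G < 1"
  obtains R C where "decidable2 no_oracle R" "\<forall>c. \<mu> (zero_block c - G) = 0 \<longrightarrow> (\<exists>t. R c t)"
    "\<forall>F. finite F \<longrightarrow> (\<forall>c\<in>F. \<exists>t. R c t) \<longrightarrow> (\<Sum>c\<in>F. 1 / 2 ^ p2 c) \<le> (C::real)"
proof -
  obtain P' where P': "open_stages no_oracle (\<lambda>_. G) P'" using ce_open_stages[OF G(1)] .
  define P where "P = P' 0"
  have P_dec: "decidable2 no_oracle P" unfolding P_def by (intro decidable_comp3[OF open_stagesD(1)[OF P']] computability)
  have P_mono: "P s (val s X) \<Longrightarrow> s \<le> t \<Longrightarrow> P t (val t X)" for s t X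
    unfolding P_def by (rule open_stagesD(2)[OF P'])
  have G_P: "G = {X. \<exists>t. P t (val t X)}" unfolding P_def by (rule open_stagesD(3)[OF P'])
  have G_sets: "G \<in> sets cantor_measure" by (rule ce_open_sets[OF G(1)])
  define h where "h = 1 - \<mu> G"
  have h: "0 < h" using G(2) by (simp add: h_def)
  have "\<exists>d. (1 / 2) ^ d < h / 4" by (rule real_arch_pow_inv) (use h in auto)
  \<comment> \<open>the allowances \<open>2 ^ - (d + c)\<close> add up to \<open>2 * 2 ^ - d\<close>, at most half of \<open>h\<close>\<close>
  then obtain d where d: "(1 / 2) ^ d < h / 4" ..
  \<comment> \<open>the string of length \<open>t\<close> and value \<open>w\<close> is neither in \<open>G\<close> by stage \<open>t\<close> nor inconsistent with \<open>zero_block c\<close>\<close>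
  define free where "free c t w \<longleftrightarrow> \<not> P t w \<and>
      (\<forall>j<p2 c. prod_encode (c, j) < t \<longrightarrow> w div 2 ^ (t - Suc (prod_encode (c, j))) mod 2 = 0)" for c t w :: nat
  define Q where "Q c t = {X. free c t (val t X)}" for c t
  define R where "R c t \<longleftrightarrow> (\<Sum>w<2 ^ t. of_bool (free c t w)) * 2 ^ (d + c) \<le> (2 ^ t :: nat)" for c t
  have R_iff: "R c t \<longleftrightarrow> \<mu> (Q c t) \<le> 1 / 2 ^ (d + c)" for c t
  proof -
    have "R c t \<longleftrightarrow> real ((\<Sum>w<2 ^ t. of_bool (free c t w)) * 2 ^ (d + c)) \<le> real (2 ^ t)"
      unfolding R_def of_nat_le_iff ..
    then show ?thesis unfolding Q_def measure_val by (simp add: field_simps)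
  qed
  have Q: "X \<in> Q c t \<longleftrightarrow> \<not> P t (val t X) \<and> (\<forall>i\<in>block c. i < t \<longrightarrow> \<not> X i)" for X c t
    unfolding Q_def free_def block_def by (auto simp: val_digit)
  have Q_sets: "Q c t \<in> sets cantor_measure" for c t unfolding Q_def by (rule sets_val)
  have Q_sub: "zero_block c - G \<subseteq> Q c t" for c t
    using G_P Q by (auto simp: zero_block_def)
  have small: "\<mu> (zero_block c - G) \<le> 1 / 2 ^ (d + c)" if R: "\<exists>t. R c t" for c
  proof -
    obtain t where "\<mu> (Q c t) \<le> 1 / 2 ^ (d + c)" using R unfolding R_iff ..
    then show ?thesis using cantor.finite_measure_mono[OF Q_sub Q_sets, of c t] by linarith
  qed
  show ?thesis
  proof (rule that)
    show "decidable2 no_oracle R" unfolding R_def free_def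
      by (intro computability decidable_comp2[OF P_dec])
    show "\<forall>c. \<mu> (zero_block c - G) = 0 \<longrightarrow> (\<exists>t. R c t)"
    proof (intro allI impI)
      fix c assume 0: "\<mu> (zero_block c - G) = 0"
      have "decseq (Q c)" using P_mono Q by (intro decseq_SucI) (auto simp del: val.simps)
      moreover have "(\<Inter>t. Q c t) = zero_block c - G"
      proof
        show "(\<Inter>t. Q c t) \<subseteq> zero_block c - G"
          unfolding G_P zero_block_def using Q by (auto simp del: val.simps) (metis lessI)
      qed (use Q_sub in blast)
      ultimately have "(\<lambda>t. \<mu> (Q c t)) \<longlonglongrightarrow> 0"
        using cantor.finite_Lim_measure_decseq[of "Q c"] Q_sets 0 by auto
      then have "\<forall>\<^sub>F t in sequentially. \<mu> (Q c t) < 1 / 2 ^ (d + c)" by (rule order_tendstoD) simp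
      then obtain t where "\<mu> (Q c t) < 1 / 2 ^ (d + c)" unfolding eventually_sequentially by blast
      then show "\<exists>t. R c t" unfolding R_iff by (intro exI[of _ t]) simp
    qed
    show "\<forall>F. finite F \<longrightarrow> (\<forall>c\<in>F. \<exists>t. R c t) \<longrightarrow> (\<Sum>c\<in>F. 1 / 2 ^ p2 c) \<le> ln (2 / h)"
    proof (intro allI impI)
      fix F :: "nat set" assume F: "finite F" "\<forall>c\<in>F. \<exists>t. R c t"
      define H where "H = UNIV - (\<Union>c\<in>F. zero_block c)"
      define N where "N = (\<Union>c\<in>F. zero_block c - G)"
      have H_sets: "H \<in> sets cantor_measure" unfolding H_def
        using F(1) sets_zero_block by (intro sets.compl_sets[of _ cantor_measure, unfolded space_cantor] sets.finite_UN) auto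
      have W_sets: "N \<in> sets cantor_measure" unfolding N_def
        using F(1) sets_zero_block G_sets by (intro sets.finite_UN sets.Diff) auto
      have "\<mu> N \<le> (\<Sum>c\<in>F. \<mu> (zero_block c - G))"
        unfolding N_def using F(1) sets_zero_block G_sets by (intro cantor.finite_measure_subadditive_finite) auto
      also have "\<dots> \<le> (\<Sum>c\<in>F. 1 / 2 ^ (d + c))" using F(2) small by (intro sum_mono) auto
      also have "\<dots> = (\<Sum>c\<in>F. (1 / 2) ^ d * (1 / 2) ^ c)"
        by (intro sum.cong) (simp_all add: power_add power_one_over)
      also have "\<dots> \<le> (\<Sum>c. (1 / 2) ^ d * (1 / 2) ^ c)"
        using F(1) by (intro sum_le_suminf summable_mult summable_geometric) auto
      also have "\<dots> = (1 / 2) ^ d * (\<Sum>c. (1 / 2) ^ c)"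
        by (rule suminf_mult) (simp add: summable_geometric)
      also have "(\<Sum>c. (1 / 2) ^ c :: real) = 2" by (subst suminf_geometric) simp_all
      finally have W: "\<mu> N \<le> h / 2" using d by linarith
      have "UNIV = G \<union> H \<union> N" by (auto simp: H_def N_def)
      then have "\<mu> UNIV \<le> \<mu> (G \<union> H) + \<mu> N"
        using measure_Un_le[of "G \<union> H" cantor_measure "N"] G_sets H_sets W_sets by auto
      moreover have "\<mu> (G \<union> H) \<le> \<mu> G + \<mu> H" using G_sets H_sets by (rule measure_Un_le)
      moreover have "\<mu> UNIV = 1" using cantor.prob_space by simp
      moreover have "\<mu> G = 1 - h" by (simp add: h_def)
      ultimately have "h / 2 \<le> \<mu> H" using W by simp
      also have "\<dots> = (\<Prod>c\<in>F. 1 - 1 / 2 ^ p2 c)" unfolding H_def by (rule measure_avoid_zero_blocks[OF F(1)])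
      also have "\<dots> \<le> (\<Prod>c\<in>F. exp (- (1 / 2 ^ p2 c)))"
      proof (rule prod_mono)
        fix c :: nat
        have "1 - 1 / 2 ^ p2 c \<le> exp (- (1 / 2 ^ p2 c) :: real)" using exp_ge_add_one_self[of "- (1 / 2 ^ p2 c)"] by simp
        then show "0 \<le> (1 - 1 / 2 ^ p2 c :: real) \<and> 1 - 1 / 2 ^ p2 c \<le> exp (- (1 / 2 ^ p2 c) :: real)" by simp
      qed
      also have "\<dots> = exp (- (\<Sum>c\<in>F. 1 / 2 ^ p2 c))" using F(1) by (simp add: exp_sum sum_negf[symmetric])
      finally have "ln (h / 2) \<le> ln (exp (- (\<Sum>c\<in>F. 1 / 2 ^ p2 c)))"
        using h by (subst ln_le_cancel_iff) auto
      then have "ln (h / 2) \<le> - (\<Sum>c\<in>F. 1 / 2 ^ p2 c)" by simp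
      moreover have "ln (2 / h) = - ln (h / 2)" using h by (simp add: ln_div)
      ultimately show "(\<Sum>c\<in>F. 1 / 2 ^ p2 c) \<le> ln (2 / h)" by linarith
    qed
  qed
qed

section \<open>Left-c.e. bounds from open covers\<close>

text \<open>
  \<open>g i\<close> collects \<open>2 ^ - k\<close> for all enumerated pairs \<open>(i, k)\<close>, plus a constant for the finitely many
  \<open>i\<close> to which the hypothesis on \<open>f\<close> does not apply. Defining \<open>g\<close> as the limit of its stages reduces summability to
  a uniform bound on finite sums at each stage.
\<close>
lemma left_ce_majorant:
  fixes f :: "nat \<Rightarrow> real"
  assumes R: "decidable2 no_oracle R"
    and C: "\<forall>F. finite F \<longrightarrow> (\<forall>c\<in>F. \<exists>t. R c t) \<longrightarrow> (\<Sum>c\<in>F. 1 / 2 ^ p2 c) \<le> (C::real)"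
    and f: "\<And>i. N \<le> i \<Longrightarrow> \<exists>k. f i \<le> 1 / 2 ^ k \<and> (\<exists>t. R (prod_encode (i, k)) t)"
  shows "\<exists>g. (\<forall>n. 0 \<le> g n) \<and> left_ce_fun g \<and> summable g \<and> f \<le> g"
proof -
  obtain K :: nat where K: "\<And>i. i < N \<Longrightarrow> f i \<le> real K"
  proof -
    obtain b where b: "\<And>i. i < N \<Longrightarrow> f i \<le> b"
      using finite_imageI[of "{..<N}" f] bdd_above_finite[of "f ` {..<N}"] by (auto simp: bdd_above_def)
    have "f i \<le> real (nat \<lceil>b\<rceil>)" if "i < N" for i using b[OF that] by linarith
    then show ?thesis by (rule that)
  qed
  define a where "a i k s \<longleftrightarrow> (\<exists>t<s. R (prod_encode (i, k)) t)" for i k s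
  define num where "num i s = (if i < N then K * 2 ^ s else 0) + (\<Sum>k<s. of_bool (a i k s) * 2 ^ (s - k))" for i s
  define q where "q i s = real (num i s) / 2 ^ s" for i s
  have q: "q i s = (if i < N then real K else 0) + (\<Sum>k<s. of_bool (a i k s) / 2 ^ k)" for i s
  proof -
    have "(\<Sum>k<s. of_bool (a i k s) * 2 ^ (s - k)) / 2 ^ s = (\<Sum>k<s. of_bool (a i k s) / 2 ^ k :: real)"
      unfolding sum_divide_distrib by (intro sum.cong) (auto simp: power_diff)
    then show ?thesis by (simp add: q_def num_def add_divide_distrib)
  qed
  have a_mono: "a i k s \<Longrightarrow> s \<le> t \<Longrightarrow> a i k t" for i k s t unfolding a_def by (meson less_le_trans)
  have q_inc: "incseq (q i)" for i
  proof (rule incseq_SucI)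
    fix s
    have "(\<Sum>k<s. of_bool (a i k s) / 2 ^ k) \<le> (\<Sum>k<s. of_bool (a i k (Suc s)) / 2 ^ k :: real)"
      using a_mono[of i _ s "Suc s"] by (intro sum_mono) (auto simp: of_bool_def)
    also have "\<dots> \<le> (\<Sum>k<Suc s. of_bool (a i k (Suc s)) / 2 ^ k)" by simp
    finally show "q i s \<le> q i (Suc s)" unfolding q by linarith
  qed
  have sum_q: "(\<Sum>i<n. q i s) \<le> real N * real K + C" for n s
  proof -
    let ?F = "{c \<in> prod_encode ` ({..<n} \<times> {..<s}). \<exists>t<s. R c t}"
    define v where "v c = (of_bool (\<exists>t<s. R c t) / 2 ^ p2 c :: real)" for c
    have "(\<Sum>i<n. \<Sum>k<s. of_bool (a i k s) / 2 ^ k :: real) = (\<Sum>i<n. \<Sum>k<s. v (prod_encode (i, k)))"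
      by (simp add: v_def a_def)
    also have "\<dots> = (\<Sum>(i, k)\<in>{..<n} \<times> {..<s}. v (prod_encode (i, k)))" by (rule sum.cartesian_product)
    also have "\<dots> = (\<Sum>x\<in>{..<n} \<times> {..<s}. v (prod_encode x))" by (rule sum.cong) auto
    also have "\<dots> = (\<Sum>c\<in>prod_encode ` ({..<n} \<times> {..<s}). v c)"
      by (rule sum.reindex[symmetric, unfolded o_def]) (rule inj_prod_encode)
    also have "\<dots> = (\<Sum>c\<in>?F. 1 / 2 ^ p2 c)"
      by (rule sum.mono_neutral_cong_right) (auto simp: v_def)
    also have "\<dots> \<le> C" by (rule C[rule_format]) auto
    finally have 1: "(\<Sum>i<n. \<Sum>k<s. of_bool (a i k s) / 2 ^ k :: real) \<le> C" .
    have "(\<Sum>i<n. if i < N then real K else 0) \<le> (\<Sum>i<max n N. if i < N then real K else 0)"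
      by (intro sum_mono2) auto
    also have "\<dots> = (\<Sum>i<N. real K)" by (rule sum.mono_neutral_cong_right) auto
    finally have "(\<Sum>i<n. if i < N then real K else 0) \<le> real N * real K" by simp
    then show ?thesis using 1 unfolding q sum.distrib by linarith
  qed
  have q_nonneg: "0 \<le> q i s" for i s by (simp add: q_def)
  have q_bound: "q i s \<le> real N * real K + C" for i s
    using sum_q[where n = "Suc i" and s = s] sum_nonneg[of "{..<i}" "\<lambda>i. q i s"] q_nonneg by simp
  have "\<exists>l. q i \<longlonglongrightarrow> l" for i
    using incseq_convergent[OF q_inc, of i "real N * real K + C"] q_bound by metis
  then obtain g where g: "\<And>i. q i \<longlonglongrightarrow> g i" by metis
  have q_le: "q i s \<le> g i" for i s by (rule incseq_le[OF q_inc g])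
  have g_nonneg: "0 \<le> g i" for i using q_nonneg q_le order_trans by blast
  have "left_ce_fun g"
  proof -
    have q_code: "q i s = real_of_rat (rat_of_code (dyadic_code (num i s) s))" for i s
      by (simp add: real_of_dyadic_code q_def)
    have "computable2 no_oracle num" unfolding num_def a_def by (intro computability decidable_comp2[OF R])
    then have "computable2 no_oracle (\<lambda>i s. dyadic_code (num i s) s)" by (intro computability)
    then have "computable_rat_array_in no_oracle (\<lambda>i s. rat_of_code (dyadic_code (num i s) s))"
      unfolding computable_rat_array_in_def by (intro exI conjI) auto
    moreover have "incseq (\<lambda>s. rat_of_code (dyadic_code (num i s) s))" for i
      using q_inc[of i] unfolding incseq_def q_code of_rat_less_eq .
    ultimately show ?thesis
      unfolding left_ce_fun_def using g[unfolded q_code]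
      by (intro exI[of _ "\<lambda>i s. rat_of_code (dyadic_code (num i s) s)"]) (simp flip: q_code)
  qed
  moreover have "summable g"
  proof (rule summableI_nonneg_bounded[OF g_nonneg])
    fix n
    have "(\<lambda>s. \<Sum>i<n. q i s) \<longlonglongrightarrow> (\<Sum>i<n. g i)" by (intro tendsto_sum g)
    then show "(\<Sum>i<n. g i) \<le> real N * real K + C" by (rule LIMSEQ_le_const2) (use sum_q in auto)
  qed
  moreover have "f i \<le> g i" for i
  proof (cases "i < N")
    case True
    then have "f i \<le> q i 0" using K by (simp add: q)
    then show ?thesis using q_le[of i 0] by linarith
  next
    case False
    then obtain k t where k: "f i \<le> 1 / 2 ^ k" "R (prod_encode (i, k)) t" using f[of i] by auto
    define s where "s = Suc (k + t)"
    have "a i k s" using k(2) unfolding a_def s_def by (intro exI[of _ t]) simp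
    then have "1 / 2 ^ k = (of_bool (a i k s) / 2 ^ k :: real)" by simp
    also have "\<dots> \<le> (\<Sum>k<s. of_bool (a i k s) / 2 ^ k)"
      by (rule member_le_sum) (auto simp: s_def)
    also have "\<dots> \<le> q i s" unfolding q by simp
    also have "\<dots> \<le> g i" by (rule q_le)
    finally show ?thesis using k(1) by linarith
  qed
  ultimately show ?thesis using g_nonneg by (intro exI[of _ g]) (auto simp: le_fun_def)
qed

lemma bounded_if_covered:
  assumes "ce_open G" "\<mu> G < 1"
    and cover: "\<And>i. M \<le> i \<Longrightarrow> \<mu> (zero_block (prod_encode (i, k i)) - G) = 0"
    and f: "\<forall>\<^sub>F i in sequentially. f i \<le> (1 / 2 ^ k i :: real)"
  shows "\<exists>g. (\<forall>n. 0 \<le> g n) \<and> left_ce_fun g \<and> summable g \<and> f \<le> g"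
proof -
  obtain R C where R: "decidable2 no_oracle R" "\<forall>c. \<mu> (zero_block c - G) = 0 \<longrightarrow> (\<exists>t. R c t)"
    "\<forall>F. finite F \<longrightarrow> (\<forall>c\<in>F. \<exists>t. R c t) \<longrightarrow> (\<Sum>c\<in>F. 1 / 2 ^ p2 c) \<le> (C::real)"
    using few_blocks_nearly_covered[OF assms(1,2)] .
  obtain N where N: "\<And>i. N \<le> i \<Longrightarrow> f i \<le> 1 / 2 ^ k i" using f unfolding eventually_sequentially by blast
  show ?thesis
  proof (rule left_ce_majorant[OF R(1,3)])
    show "\<exists>k. f i \<le> 1 / 2 ^ k \<and> (\<exists>t. R (prod_encode (i, k)) t)" if "max M N \<le> i" for i
      using that N[of i] R(2) cover[of i] by auto
  qed
qed

section \<open>Random points outside fat open sets\<close>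

lemma ce_open_Un:
  assumes "ce_open G" "ce_open H" shows "ce_open (G \<union> H)"
proof -
  obtain P where "open_stages no_oracle (\<lambda>_. G) P" using ce_open_stages[OF assms(1)] .
  note P = open_stagesD[OF this]
  obtain Q where "open_stages no_oracle (\<lambda>_. H) Q" using ce_open_stages[OF assms(2)] .
  note Q = open_stagesD[OF this]
  have "G \<union> H = {X. \<exists>t. P 0 t (val t X) \<or> Q 0 t (val t X)}"
    using P(3)[of 0] Q(3)[of 0] by auto
  also have "ce_open \<dots>"
    by (rule ce_openI1) (intro computability decidable_comp3[OF P(1)] decidable_comp3[OF Q(1)])+
  finally show ?thesis .
qed

lemma ce_open_component:
  assumes "uniformly_ce_open_in no_oracle U" shows "ce_open (U k)"
proof -
  obtain P where "open_stages no_oracle U P" using ce_openE[OF assms] .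
  note P = open_stagesD[OF this]
  have "U k = {X. \<exists>t. P k t (val t X)}" by (rule P(3))
  also have "ce_open \<dots>"
    by (rule ce_openI1) (intro computability decidable_comp3[OF P(1)])+
  finally show ?thesis .
qed

lemma ce_open_val_neq: "ce_open {X. val l X \<noteq> v}"
proof -
  have "ce_open {X. \<exists>z::nat. (\<lambda>_ w. w \<noteq> v) z (val ((\<lambda>_. l) z) X)}"
    by (rule ce_openI1) (intro computability)+
  then show ?thesis by simp
qed

instance prog :: countable
  by countable_datatype

text \<open>
  A test is determined by a program enumerating it.
\<close>
lemma countable_MartinLoef_tests: "countable {U. MartinLoef_test U}"
proof -
  define T where "T p n = (\<Union>s\<in>{s. prod_encode (n, string_code s) \<in> dom (run no_oracle p)}. cylinder s)" for p n
  have "{U. MartinLoef_test U} \<subseteq> range T"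
  proof
    fix U assume "U \<in> {U. MartinLoef_test U}"
    then obtain p where "\<forall>n. U n = T p n"
      unfolding MartinLoef_test_def uniformly_ce_open_in_def ce_in_def T_def by blast
    then have "U = T p" by blast
    then show "U \<in> range T" by blast
  qed
  then show ?thesis by (rule countable_subset) simp
qed

text \<open>
  Conditions of the forcing argument: \<open>G\<close> is the open set to be avoided, and the first \<open>l\<close> bits of
  \<open>Y\<close> are the part of the point decided so far. Avoidance must be possible with positive
  probability, which is what allows small open sets to be added to \<open>G\<close>.
\<close>
definition positive_outside :: "cantor set \<times> cantor \<times> nat \<Rightarrow> bool" where
  "positive_outside = (\<lambda>(G, Y, l). ce_open G \<and> 0 < \<mu> ({X. val l X = val l Y} - G))"

text \<open>
  Adding the complement of the current cylinder to \<open>G\<close> gives a c.e. open set of measure below \<open>1\<close>, so \<open>V n\<close>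
  meets its complement in positive measure. By countable additivity this holds for one of the cylinders
  making up \<open>V n\<close>, and there is room to avoid in addition a component of \<open>T\<close> whose measure is small enough.
\<close>
lemma forcing_step:
  assumes V: "uniformly_ce_open_in A V" and fat: "\<And>G n. ce_open G \<Longrightarrow> \<mu> G < 1 \<Longrightarrow> \<mu> (V n - G) \<noteq> 0"
    and s: "positive_outside (G, Y, l)"
  shows "\<exists>G' Y' l'. positive_outside (G', Y', l') \<and> l < l' \<and> val l Y' = val l Y \<and> G \<subseteq> G' \<and>
    {X. val l' X = val l' Y'} \<subseteq> V n \<and> (MartinLoef_test T \<longrightarrow> (\<exists>k. T k \<subseteq> G'))"
proof -
  obtain P where "open_stages A V P" using ce_openE[OF V] .
  note P = open_stagesD[OF this]
  have G: "ce_open G" "0 < \<mu> ({X. val l X = val l Y} - G)" using s by (auto simp: positive_outside_def)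
  have G_sets: "G \<in> sets cantor_measure" by (rule ce_open_sets[OF G(1)])
  have cyl_sets: "{X. val t X = v} \<in> sets cantor_measure" for t v by (rule sets_val)
  define G1 where "G1 = G \<union> {X. val l X \<noteq> val l Y}"
  have G1: "ce_open G1" unfolding G1_def by (intro ce_open_Un G(1) ce_open_val_neq)
  have G1_sets: "G1 \<in> sets cantor_measure" by (rule ce_open_sets[OF G1])
  have "space cantor_measure - G1 = {X. val l X = val l Y} - G" by (auto simp: G1_def)
  then have "1 - \<mu> G1 = \<mu> ({X. val l X = val l Y} - G)" using cantor.prob_compl[OF G1_sets] by simp
  then have "\<mu> G1 < 1" using G(2) by simp
  then have pos: "\<mu> (V n - G1) \<noteq> 0" by (rule fat[OF G1])
  have "\<exists>t v. l < t \<and> P n t v \<and> \<mu> ({X. val t X = v} - G1) \<noteq> 0"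
  proof (rule ccontr)
    assume *: "\<not> ?thesis"
    \<comment> \<open>restricting to strings longer than \<open>l\<close> loses no point, since acceptance by \<open>P\<close> persists for longer prefixes\<close>
    define N where "N x = (if l < p1 x \<and> P n (p1 x) (p2 x) then {X. val (p1 x) X = p2 x} - G1 else {})" for x
    have N_sets: "N x \<in> sets cantor_measure" for x unfolding N_def using cyl_sets G1_sets by auto
    have N_null: "\<mu> (N x) = 0" for x using * by (auto simp: N_def)
    have "V n - G1 \<subseteq> (\<Union>x. N x)"
    proof
      fix X assume X: "X \<in> V n - G1"
      then obtain t where "P n t (val t X)" unfolding P(3)[of n] by blast
      then have "P n (max t (Suc l)) (val (max t (Suc l)) X)" by (rule P(2)) simp
      then have "X \<in> N (prod_encode (max t (Suc l), val (max t (Suc l)) X))" using X by (simp add: N_def)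
      then show "X \<in> (\<Union>x. N x)" by blast
    qed
    then have "\<mu> (V n - G1) \<le> \<mu> (\<Union>x. N x)"
      using N_sets by (intro cantor.finite_measure_mono sets.countable_UN) auto
    also have "\<dots> \<le> (\<Sum>x. \<mu> (N x))"
      using N_sets by (intro cantor.finite_measure_subadditive_countably) (auto simp: N_null)
    also have "\<dots> = 0" by (simp add: N_null)
    finally show False using pos measure_nonneg[of cantor_measure "V n - G1"] by simp
  qed
  then obtain t v where tv: "l < t" "P n t v" "\<mu> ({X. val t X = v} - G1) \<noteq> 0" by blast
  then have "{X. val t X = v} - G1 \<noteq> {}" by (metis measure_empty)
  then obtain Y' where Y': "val t Y' = v" "val l Y' = val l Y" unfolding G1_def by auto
  have sub: "{X. val t X = val t Y'} \<subseteq> {X. val l X = val l Y}"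
    using tv(1) Y'(2) by (auto simp: val_eq_iff)
  then have "{X. val t X = v} - G1 = {X. val t X = val t Y'} - G" unfolding G1_def Y'(1) by auto
  then have pos': "0 < \<mu> ({X. val t X = val t Y'} - G)"
    using tv(3) by (simp add: zero_less_measure_iff)
  obtain H where H: "ce_open H" "\<mu> H < \<mu> ({X. val t X = val t Y'} - G)" "MartinLoef_test T \<longrightarrow> (\<exists>k. T k \<subseteq> H)"
  proof (cases "MartinLoef_test T")
    case True
    have "\<exists>k. (1 / 2) ^ k < \<mu> ({X. val t X = val t Y'} - G)" by (rule real_arch_pow_inv[OF pos']) simp
    then obtain k where "(1 / 2) ^ k < \<mu> ({X. val t X = val t Y'} - G)" ..
    moreover have "\<mu> (T k) \<le> (1 / 2) ^ k" using True unfolding MartinLoef_test_def by (simp add: power_one_over)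
    moreover have "ce_open (T k)" using True unfolding MartinLoef_test_def by (intro ce_open_component) blast
    ultimately show ?thesis by (intro that[of "T k"]) auto
  next
    case False
    have "ce_open {X. val 0 X \<noteq> 0}" by (rule ce_open_val_neq)
    then show ?thesis using that[of "{}"] False pos' by simp
  qed
  have "{X. val t X = val t Y'} - G \<subseteq> ({X. val t X = val t Y'} - (G \<union> H)) \<union> H" by blast
  then have "\<mu> ({X. val t X = val t Y'} - G) \<le> \<mu> (({X. val t X = val t Y'} - (G \<union> H)) \<union> H)"
    using cyl_sets G_sets ce_open_sets[OF H(1)] by (intro cantor.finite_measure_mono) auto
  also have "\<dots> \<le> \<mu> ({X. val t X = val t Y'} - (G \<union> H)) + \<mu> H"
    using cyl_sets G_sets ce_open_sets[OF H(1)] by (intro measure_Un_le) auto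
  finally have "positive_outside (G \<union> H, Y', t)"
    using H(2) ce_open_Un[OF G(1) H(1)] by (simp add: positive_outside_def)
  moreover have "{X. val t X = val t Y'} \<subseteq> V n" using tv(2) Y'(1) unfolding P(3)[of n] by (auto intro!: exI[of _ t])
  ultimately show ?thesis using tv(1) Y'(2) H(3)
    by (intro exI[of _ "G \<union> H"] exI[of _ Y'] exI[of _ t]) blast
qed

text \<open>
  If no such \<open>G\<close> existed, iterating \<open>forcing_step\<close> along the components of \<open>V\<close> and along an enumeration of all
  Martin-Loef tests would produce a random point captured by \<open>V\<close>.
\<close>
lemma ex_cover_if_Low:
  assumes low: "MLR \<subseteq> SR A" and V: "Schnorr_test_in A V"
  shows "\<exists>G n. ce_open G \<and> \<mu> G < 1 \<and> \<mu> (V n - G) = 0"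
proof (rule ccontr)
  assume "\<not> ?thesis"
  then have fat: "\<mu> (V n - G) \<noteq> 0" if "ce_open G" "\<mu> G < 1" for G n using that by blast
  have V_ce: "uniformly_ce_open_in A V" using V unfolding Schnorr_test_in_def by blast
  \<comment> \<open>entries that are no tests, should there be any, impose no requirement in \<open>forcing_step\<close>\<close>
  define T where "T = from_nat_into {U. MartinLoef_test U}"
  have T: "\<exists>e. U = T e" if "MartinLoef_test U" for U
    using subset_range_from_nat_into[OF countable_MartinLoef_tests] that unfolding T_def by auto
  define step where "step e = (\<lambda>(G, Y, l) (G', Y', l'). l < l' \<and> val l Y' = val l Y \<and> G \<subseteq> G' \<and>
    {X. val l' X = val l' Y'} \<subseteq> V e \<and> (MartinLoef_test (T e) \<longrightarrow> (\<exists>k. T e k \<subseteq> G')))"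
    for e :: nat and s s' :: "cantor set \<times> cantor \<times> nat"
  have "ce_open {}" using ce_open_val_neq[of 0 0] by simp
  then have "positive_outside ({}, \<lambda>_. False, 0)"
    using cantor.prob_space by (simp add: positive_outside_def)
  moreover have "\<exists>s'. positive_outside s' \<and> step e s s'" if "positive_outside s" for s e
  proof -
    obtain G Y l where s: "s = (G, Y, l)" by (cases s)
    from forcing_step[OF V_ce fat that[unfolded s], of e "T e"] show ?thesis
      unfolding s step_def by auto
  qed
  ultimately obtain S where S: "\<And>e. positive_outside (S e)" "\<And>e. step e (S e) (S (Suc e))"
    using dependent_nat_choice[of "\<lambda>_ s. positive_outside s" step] by metis
  define G where "G e = fst (S e)" for e
  define Y where "Y e = fst (snd (S e))" for e
  define l where "l e = snd (snd (S e))" for e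
  have S_eq: "S e = (G e, Y e, l e)" for e by (simp add: G_def Y_def l_def)
  have pos: "ce_open (G e)" "0 < \<mu> ({X. val (l e) X = val (l e) (Y e)} - G e)" for e
    using S(1)[of e] unfolding S_eq positive_outside_def by auto
  have st: "l e < l (Suc e)" "val (l e) (Y (Suc e)) = val (l e) (Y e)" "G e \<subseteq> G (Suc e)"
    "{X. val (l (Suc e)) X = val (l (Suc e)) (Y (Suc e))} \<subseteq> V e"
    "MartinLoef_test (T e) \<Longrightarrow> \<exists>k. T e k \<subseteq> G (Suc e)" for e
    using S(2)[of e] unfolding S_eq step_def by auto
  have l_mono: "strict_mono l" using st(1) by (simp add: strict_mono_Suc_iff)
  have l_ge: "e \<le> l e" for e by (rule strict_mono_imp_increasing[OF l_mono])
  have G_mono: "G d \<subseteq> G e" if "d \<le> e" for d e by (rule lift_Suc_mono_le[where f = G, OF st(3) that])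
  have Y_stable: "Y e i = Y d i" if "d \<le> e" "i < l d" for d e i
    using that
  proof (induction e rule: dec_induct)
    case (step e)
    then have "i < l e" using l_mono by (meson less_le_trans strict_mono_less_eq)
    then show ?case using st(2)[of e] step.IH step.prems unfolding val_eq_iff by auto
  qed simp
  \<comment> \<open>bit \<open>i\<close> is decided after \<open>i + 1\<close> steps because every step lengthens the prefix\<close>
  define Z where "Z i = Y (Suc i) i" for i
  have Z: "val (l e) Z = val (l e) (Y e)" for e
    unfolding val_eq_iff Z_def
  proof (intro allI impI)
    fix i assume i: "i < l e"
    have "i < l (Suc i)" using l_ge[of "Suc i"] by simp
    then show "Y (Suc i) i = Y e i"
      using Y_stable[of e "Suc i" i] Y_stable[of "Suc i" e i] i by (cases "e \<le> Suc i") auto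
  qed
  have Z_V: "Z \<in> V e" for e using st(4)[of e] Z[of "Suc e"] by blast
  have Z_G: "Z \<notin> G e" for e
  proof
    assume "Z \<in> G e"
    obtain P where "open_stages no_oracle (\<lambda>_. G e) P" using ce_open_stages[OF pos(1)] .
    note P = open_stagesD(3)[OF this]
    obtain t where t: "P 0 t (val t Z)" using \<open>Z \<in> G e\<close> unfolding P[of 0] by blast
    let ?m = "max e t"
    have "X \<in> G ?m" if X: "val (l ?m) X = val (l ?m) (Y ?m)" for X
    proof -
      have "t \<le> l ?m" using l_ge[of ?m] by simp
      then have "val t X = val t Z" using X unfolding Z[symmetric] val_eq_iff by auto
      then have "X \<in> G e" using t unfolding P[of 0] by (auto intro!: exI[of _ t])
      then show ?thesis using G_mono[of e ?m] by auto
    qed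
    then have empty: "{X. val (l ?m) X = val (l ?m) (Y ?m)} - G ?m = {}" by blast
    show False using pos(2)[of ?m] unfolding empty by simp
  qed
  have "Z \<in> MLR" unfolding MLR_def
  proof (intro CollectI allI impI notI)
    fix U assume U: "MartinLoef_test U" "Z \<in> (\<Inter>n. U n)"
    then obtain e where "U = T e" using T by blast
    then obtain k where "U k \<subseteq> G (Suc e)" using st(5)[of e] U(1) by blast
    then show False using U(2) Z_G by blast
  qed
  then show False using low V Z_V unfolding SR_def by blast
qed

lemma bounded_if_Low:
  assumes low: "MLR \<subseteq> SR A"
    and f: "\<And>n. 0 \<le> f n" "computable_real_fun_in A f" "summable f" "computable_real_in A (\<Sum>n. f n)"
  shows "\<exists>g. (\<forall>n. 0 \<le> g n) \<and> left_ce_fun g \<and> summable g \<and> f \<le> g"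
proof -
  obtain k m where k: "computable_in A k" and m: "computable_in A m" "mono m" "\<forall>n. n \<le> m n"
    and f_le: "\<forall>\<^sub>F i in sequentially. f i \<le> 1 / 2 ^ k i"
    and x: "summable (\<lambda>i. 1 / 2 ^ k i :: real)" "\<forall>n. (\<Sum>i. 1 / 2 ^ k (i + m n)) \<le> (1 / 2 ^ Suc n :: real)"
    using ex_dyadic_majorant[OF f] .
  obtain V where V: "Schnorr_test_in A V" "\<forall>n i. m n \<le> i \<longrightarrow> zero_block (prod_encode (i, k i)) \<subseteq> V n"
    using Schnorr_test_zero_blocks[OF k m x] .
  obtain G n where G: "ce_open G" "\<mu> G < 1" "\<mu> (V n - G) = 0"
    using ex_cover_if_Low[OF low V(1)] by blast
  have V_sets: "V n \<in> sets cantor_measure"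
  proof (rule ccontr)
    \<comment> \<open>a nonmeasurable set has measure \<open>0\<close> by convention, but the components of a Schnorr test have positive measure\<close>
    assume "V n \<notin> sets cantor_measure"
    then have "\<mu> (V n) = 0" by (rule measure_notin_sets)
    then show False using V(1) unfolding Schnorr_test_in_def by (metis divide_eq_0_iff power_eq_0_iff zero_neq_numeral zero_neq_one)
  qed
  show ?thesis
  proof (rule bounded_if_covered[OF G(1,2) _ f_le])
    fix i assume "m n \<le> i"
    then have "\<mu> (zero_block (prod_encode (i, k i)) - G) \<le> \<mu> (V n - G)"
      using V(2) V_sets ce_open_sets[OF G(1)] by (intro cantor.finite_measure_mono) auto
    then show "\<mu> (zero_block (prod_encode (i, k i)) - G) = 0"
      using G(3) measure_nonneg[of cantor_measure "zero_block (prod_encode (i, k i)) - G"] by linarith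
  qed
qed

section \<open>Lowness and left-c.e. bounds\<close>

theorem proposition5p2:
  fixes A :: cantor
  shows
    "(A \<in> Low MLR SR \<longleftrightarrow>
       (\<forall>f :: nat \<Rightarrow> real.
          (\<forall>n. 0 \<le> f n) \<and> computable_real_fun_in A f \<and>
          summable f \<and> computable_real_in no_oracle (\<Sum>n. f n) \<longrightarrow>
          (\<exists>g :: nat \<Rightarrow> real. (\<forall>n. 0 \<le> g n) \<and> left_ce_fun g \<and> summable g \<and> f \<le> g)))
     \<and>
     (A \<in> Low MLR SR \<longleftrightarrow>
       (\<forall>f :: nat \<Rightarrow> real.
          (\<forall>n. 0 \<le> f n) \<and> computable_real_fun_in A f \<and>
          summable f \<and> computable_real_in A (\<Sum>n. f n) \<longrightarrow>
          (\<exists>g :: nat \<Rightarrow> real. (\<forall>n. 0 \<le> g n) \<and> left_ce_fun g \<and> summable g \<and> f \<le> g)))"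
    (is "(?low \<longleftrightarrow> ?bdd no_oracle) \<and> (?low \<longleftrightarrow> ?bdd A)")
proof -
  have "?bdd A" if ?low
    using bounded_if_Low[of A] that unfolding Low_def by blast
  moreover have "?bdd no_oracle" if "?bdd A"
  proof -
    have "computable_real_in A r" if "computable_real_in no_oracle r" for r
      using that computable_oracle_free unfolding computable_real_in_def by blast
    then show ?thesis using that by blast
  qed
  moreover have ?low if "?bdd no_oracle"
    using MLR_subset_SR_if_bounded[of A] that unfolding Low_def by blast
  ultimately show ?thesis by blast
qed

end
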